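(* Let $G=(V,E)$ be a finite connected graph, $M$ a positive transition matrix on $G$ with invariant distribution $\rho$, and $1\le n\le |V|$. The Markov chain with the "add a random step and erase the oldest edge" kernel $K_n$ on the set $S_n$ (both described in the context) is ergodic on $S_n$, and its invariant distribution is the distribution of the pioneer tree $\mathrm{PRT}_n(W_i,0\le i\le\tau_n)$, where $W$ is a Markov chain with transition matrix $M$ and $W_0$ follows the invariant distribution $\rho$ of $M$. This distribution has full support on $S_n$.
   Context: A transition matrix $M=(M_{a,b})_{a,b\in V}$ is positive on $G$ if $M_{a,b}>0\Leftrightarrow\{a,b\}\in E$. Let $\rho$ be its unique invariant distribution and $\overleftarrow M_{x,y}=\rho_yM_{y,x}/\rho_x$ the time-reversed transition matrix. $M$ is not assumed to be reversible. Pioneer tree: for a Markov chain $W=(W_k)_{k\ge0}$ with transition matrix $M$, let $\tau_k=\inf\{j:|\{W_0,\dots,W_j\}|=k\}$. $\mathrm{PRT}_n(W_i,0\le i\le\tau_n)$ is the edge-labelled tree with vertex set $\{W_0,\dots,W_{\tau_n}\}$, rooted at $W_0$, with oriented edges $(W_{\tau_k},W_{\tau_k-1})$ for $2\le k\le n$, the edge $(W_{\tau_k},W_{\tau_k-1})$ carrying the label $k-1$. $S_n=\bigcup_{r\in V}S_{n,r}$, where $S_{n,r}$ is the set of pairs $((t,r),\ell)$ with $t$ a subtree of $G$ with $n$ vertices containing $r$, rooted at $r$ (edges oriented toward $r$), and $\ell$ a labelling of its $n-1$ edges such that the labels form the set $\{1,\dots,n-1\}$ and are decreasing along any injective path from a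 leaf to the root $r$ (the root is not considered as a leaf). Kernel $K_n$: from $((T_0,R_0),L_0)\in S_n$, define $((T_1,R_1),L_1)$ as follows. First choose $R_1$ with $\mathbb P(R_1=v\mid R_0=u)=\overleftarrow M_{u,v}$; $R_1$ is the root of $T_1$. Put $e=(R_0,R_1)$. (a) If $R_1=R_0$ (possible if there is a loop), set $((T_1,R_1),L_1)=((T_0,R_0),L_0)$. (b) If $R_1\ne R_0$ is already a vertex of $T_0$, adding $e$ to $T_0$ creates a cycle (possibly the small cycle $R_0\to R_1\to R_0$ made of $e$ and an edge of $T_0$ with the same endpoints). Add $e$, label it temporarily $0$, let $\mathbf m$ be the maximal label on the created cycle, remove the edge with label $\mathbf m$, and orient the remaining edges of the cycle toward the new root $R_1$. (c) If $R_1$ is not a vertex of $T_0$, add $e$ (and the vertex $R_1$) to $T_0$, label $e$ temporarily $0$, and remove the edge, adjacent to a leaf, with maximal label $\mathbf m=n-1$ (together with that leaf). In cases (b) and (c), $L_1$ is obtained by keeping the labels $>\mathbf m$ and adding $1$ to all the other labels (those in $\{0,\dots,\mathbf m-1\}$, including that of the new edge temporarily labelled $0$). *)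

theory Defs
  imports "HOL-Probability.Probability"
begin

text \<open>Undirected edges are sets of endpoints, so that a loop at \<open>a\<close> is the edge \<open>{a, a} = {a}\<close>.\<close>

definition graph_on :: "'v set \<Rightarrow> 'v set set \<Rightarrow> bool" where
  "graph_on V E \<longleftrightarrow> (\<forall>e\<in>E. \<exists>a\<in>V. \<exists>b\<in>V. e = {a, b})"

definition connected_graph :: "'v set \<Rightarrow> 'v set set \<Rightarrow> bool" where
  "connected_graph V E \<longleftrightarrow>
     V \<noteq> {} \<and> graph_on V E \<and> (\<forall>a\<in>V. \<forall>b\<in>V. (a, b) \<in> {(x, y). {x, y} \<in> E}\<^sup>*)"

text \<open>A cycle is the list of its (distinct) vertices in cyclic order. A loop is a cycle with one
  vertex; two vertices joined by an edge do not form a cycle, as edges are not multiple.\<close>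

definition is_cycle :: "'v set set \<Rightarrow> 'v list \<Rightarrow> bool" where
  "is_cycle E p \<longleftrightarrow> p \<noteq> [] \<and> length p \<noteq> 2 \<and> distinct p \<and>
     successively (\<lambda>a b. {a, b} \<in> E) p \<and> {last p, hd p} \<in> E"

definition is_tree :: "'v set \<Rightarrow> 'v set set \<Rightarrow> bool" where
  "is_tree U F \<longleftrightarrow> finite U \<and> connected_graph U F \<and> (\<nexists>p. is_cycle F p)"

definition undirected :: "('v \<times> 'v) set \<Rightarrow> 'v set set" where
  "undirected A = (\<lambda>(a, b). {a, b}) ` A"

text \<open>Each tree edge occurs in \<open>A\<close> in exactly one of its two orientations. In a tree, all edges
  point toward \<open>r\<close> iff every vertex is joined to \<open>r\<close> by a directed path.\<close>

definition rooted_tree :: "'v set \<Rightarrow> ('v \<times> 'v) set \<Rightarrow> 'v \<Rightarrow> bool" where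
  "rooted_tree U A r \<longleftrightarrow> r \<in> U \<and> is_tree U (undirected A) \<and>
     (\<forall>(a, b)\<in>A. (b, a) \<notin> A) \<and> (\<forall>u\<in>U. (u, r) \<in> A\<^sup>*)"

definition is_leaf :: "('v \<times> 'v) set \<Rightarrow> 'v \<Rightarrow> 'v \<Rightarrow> bool" where
  "is_leaf A r x \<longleftrightarrow> x \<noteq> r \<and> card {f \<in> A. fst f = x \<or> snd f = x} = 1"

text \<open>\<open>(((U, A), r), l)\<close>: vertex set, arcs, root, and edge labelling, whose domain is \<open>A\<close>.\<close>

type_synonym 'v ltree = "(('v set \<times> ('v \<times> 'v) set) \<times> 'v) \<times> ('v \<times> 'v \<rightharpoonup> nat)"

definition decreasing_labels :: "('v \<times> 'v) set \<Rightarrow> 'v \<Rightarrow> ('v \<times> 'v \<rightharpoonup> nat) \<Rightarrow> bool" where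
  "decreasing_labels A r l \<longleftrightarrow>
     (\<forall>p. p \<noteq> [] \<and> distinct p \<and> successively (\<lambda>a b. (a, b) \<in> A) p \<and>
          is_leaf A r (hd p) \<and> last p = r \<longrightarrow>
          sorted_wrt (>) (map (\<lambda>f. the (l f)) (zip p (tl p))))"

text \<open>A tree with \<open>n\<close> vertices has \<open>n - 1\<close> edges, so the condition on \<open>ran l\<close> makes the labels
  of distinct edges distinct.\<close>

definition S :: "'v set \<Rightarrow> 'v set set \<Rightarrow> nat \<Rightarrow> 'v ltree set" where
  "S V E n = {(((U, A), r), l) | U A r l.
     rooted_tree U A r \<and> U \<subseteq> V \<and> undirected A \<subseteq> E \<and> card U = n \<and>
     dom l = A \<and> ran l = {1..n - 1} \<and> decreasing_labels A r l}"

definition transition_matrix :: "'s set \<Rightarrow> ('s \<Rightarrow> 's \<Rightarrow> real) \<Rightarrow> bool" where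
  "transition_matrix X P \<longleftrightarrow> (\<forall>x\<in>X. (\<forall>y\<in>X. P x y \<ge> 0) \<and> (\<Sum>y\<in>X. P x y) = 1)"

definition positive_on :: "'v set \<Rightarrow> 'v set set \<Rightarrow> ('v \<Rightarrow> 'v \<Rightarrow> real) \<Rightarrow> bool" where
  "positive_on V E M \<longleftrightarrow> (\<forall>a\<in>V. \<forall>b\<in>V. M a b > 0 \<longleftrightarrow> {a, b} \<in> E)"

definition invariant_distribution :: "'s set \<Rightarrow> ('s \<Rightarrow> 's \<Rightarrow> real) \<Rightarrow> ('s \<Rightarrow> real) \<Rightarrow> bool" where
  "invariant_distribution X P \<mu> \<longleftrightarrow> (\<forall>x\<in>X. \<mu> x \<ge> 0) \<and> (\<Sum>x\<in>X. \<mu> x) = 1 \<and>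
     (\<forall>y\<in>X. (\<Sum>x\<in>X. \<mu> x * P x y) = \<mu> y)"

definition time_reversal :: "('v \<Rightarrow> real) \<Rightarrow> ('v \<Rightarrow> 'v \<Rightarrow> real) \<Rightarrow> 'v \<Rightarrow> 'v \<Rightarrow> real" where
  "time_reversal \<rho> M x y = \<rho> y * M y x / \<rho> x"

definition irreducible_on :: "'s set \<Rightarrow> ('s \<Rightarrow> 's \<Rightarrow> real) \<Rightarrow> bool" where
  "irreducible_on X P \<longleftrightarrow> (\<forall>x\<in>X. \<forall>y\<in>X. (x, y) \<in> {(a, b). a \<in> X \<and> b \<in> X \<and> P a b > 0}\<^sup>*)"

text \<open>Ergodic means irreducible and positive recurrent, the latter being automatic on a finite
  set. Aperiodicity is not included: for the graph consisting of a single edge, the chains below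
  have period 2.\<close>

definition ergodic_on :: "'s set \<Rightarrow> ('s \<Rightarrow> 's \<Rightarrow> real) \<Rightarrow> bool" where
  "ergodic_on X P \<longleftrightarrow> finite X \<and> X \<noteq> {} \<and> transition_matrix X P \<and> irreducible_on X P"

definition shift_label :: "nat \<Rightarrow> nat \<Rightarrow> nat" where
  "shift_label m k = (if k > m then k else k + 1)"

text \<open>For \<open>v \<in> U\<close>, the arcs of \<open>A\<close> point toward \<open>r\<close>, so the cycle created by \<open>(r, v)\<close> is a
  directed one: it consists of the arcs \<open>(a, b)\<close> such that \<open>b\<close> leads back to \<open>a\<close>. This includes
  the cycle formed by \<open>(r, v)\<close> and \<open>(v, r)\<close>.\<close>

definition cycle_arcs :: "('v \<times> 'v) set \<Rightarrow> ('v \<times> 'v) set" where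
  "cycle_arcs B = {(a, b) \<in> B. (b, a) \<in> B\<^sup>*}"

text \<open>Orients the arcs of \<open>D\<close> that belong to \<open>C\<close> toward \<open>v\<close>; the label of an arc follows it.\<close>

definition orient :: "('v \<times> 'v) set \<Rightarrow> ('v \<times> 'v) set \<Rightarrow> 'v \<Rightarrow> 'v \<times> 'v \<Rightarrow> 'v \<times> 'v" where
  "orient C D v = (\<lambda>(a, b). if (a, b) \<in> C \<and> (b, v) \<notin> D\<^sup>* then (b, a) else (a, b))"

definition move_inside :: "'v ltree \<Rightarrow> 'v \<Rightarrow> 'v ltree" where
  "move_inside = (\<lambda>(((U, A), r), l) v.
     let B = insert (r, v) A;
         l0 = l((r, v) \<mapsto> 0);
         C = cycle_arcs B;
         m = Max {k. \<exists>f\<in>C. l0 f = Some k};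
         D = {f \<in> B. l0 f \<noteq> Some m};
         A' = orient C D v ` D;
         l' = (\<lambda>(a, b). if (a, b) \<in> A'
                then map_option (shift_label m) (if (a, b) \<in> D then l0 (a, b) else l0 (b, a))
                else None)
     in (((U, A'), v), l'))"

text \<open>The leaf removed below is a leaf of the tree rooted at \<open>v\<close>. For \<open>n = 1\<close> the removed edge
  is the added one, labelled 0, and the removed leaf is \<open>r\<close>.\<close>

definition move_outside :: "'v ltree \<Rightarrow> 'v \<Rightarrow> 'v ltree" where
  "move_outside = (\<lambda>(((U, A), r), l) v.
     let B = insert (r, v) A;
         l0 = l((r, v) \<mapsto> 0);
         m = Max (ran l0);
         D = {f \<in> B. l0 f \<noteq> Some m};
         X = {x. is_leaf B v x \<and> (\<exists>f\<in>B - D. x = fst f \<or> x = snd f)};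
         l' = (\<lambda>f. if f \<in> D then map_option (shift_label m) (l0 f) else None)
     in (((insert v U - X, D), v), l'))"

definition move :: "'v ltree \<Rightarrow> 'v \<Rightarrow> 'v ltree" where
  "move = (\<lambda>(((U, A), r), l) v.
     if v = r then (((U, A), r), l)
     else if v \<in> U then move_inside (((U, A), r), l) v
     else move_outside (((U, A), r), l) v)"

definition root :: "'v ltree \<Rightarrow> 'v" where
  "root s = snd (fst s)"

definition K :: "'v set \<Rightarrow> ('v \<Rightarrow> 'v \<Rightarrow> real) \<Rightarrow> ('v \<Rightarrow> real) \<Rightarrow> 'v ltree \<Rightarrow> 'v ltree \<Rightarrow> real" where
  "K V M \<rho> s t = (\<Sum>v\<in>{v \<in> V. move s v = t}. time_reversal \<rho> M (root s) v)"

definition markov_chain :: "'w measure \<Rightarrow> 'v set \<Rightarrow> ('v \<Rightarrow> 'v \<Rightarrow> real) \<Rightarrow> (nat \<Rightarrow> 'w \<Rightarrow> 'v) \<Rightarrow> bool" where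
  "markov_chain \<Omega> V M W \<longleftrightarrow> prob_space \<Omega> \<and>
     (\<forall>k. W k \<in> measurable \<Omega> (count_space V)) \<and>
     (\<forall>k w. \<forall>y\<in>V. \<P>(\<omega> in \<Omega>. \<forall>i\<le>k. W i \<omega> = w i) > 0 \<longrightarrow>
        \<P>(\<omega> in \<Omega>. W (Suc k) \<omega> = y \<bar> \<forall>i\<le>k. W i \<omega> = w i) = M (w k) y)"

text \<open>The infimum is infinite when \<open>w\<close> visits fewer than \<open>k\<close> vertices; it is then set to 0. For
  \<open>k \<le> card V\<close> this almost surely does not happen for an irreducible chain on \<open>V\<close>.\<close>

definition hitting :: "(nat \<Rightarrow> 'v) \<Rightarrow> nat \<Rightarrow> nat" where
  "hitting w k = Inf {j. card (w ` {0..j}) = k}"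

definition prt :: "nat \<Rightarrow> (nat \<Rightarrow> 'v) \<Rightarrow> 'v ltree" where
  "prt n w =
     (let arc = (\<lambda>k. (w (hitting w k), w (hitting w k - 1)))
      in (((w ` {0..hitting w n}, arc ` {2..n}), w 0),
          map_of (map (\<lambda>k. (arc k, k - 1)) [2..<n + 1])))"

definition prt_law :: "'w measure \<Rightarrow> nat \<Rightarrow> (nat \<Rightarrow> 'w \<Rightarrow> 'v) \<Rightarrow> 'v ltree \<Rightarrow> real" where
  "prt_law \<Omega> n W s = \<P>(\<omega> in \<Omega>. prt n (\<lambda>i. W i \<omega>) = s)"

end

theory Submission
  imports Defs
begin

text \<open>
  The kernel is the effect, on the pioneer tree of a trajectory, of adding one step in the past.
  Prepending a vertex \<open>v\<close> to a trajectory that starts at \<open>r \<noteq> v\<close> makes \<open>r\<close> the second vertex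
  visited, entered from \<open>v\<close>, hence the new arc \<open>(r, v)\<close> with the smallest label. It destroys one
  arc: the one by which \<open>v\<close> was entered, if \<open>v\<close> was among the first \<open>n\<close> vertices, and otherwise the
  arc of the last vertex, which is now number \<open>n + 1\<close>. In the first case the arc of \<open>v\<close> is the
  oldest one on the cycle, since labels decrease toward the root; so what is left of the cycle
  already points toward \<open>v\<close>. Thus \<open>move\<close> applied to the tree of a trajectory is the tree of the
  longer trajectory (\<open>move_pioneer_tree\<close>). As the new vertex is drawn from the time reversal of
  \<open>M\<close>, the law of the pioneer tree of a stationary chain is invariant.

  The combinatorics is carried by lists of arcs in the order of their labels. A list is
  \<open>growing\<close> from \<open>r\<close> if each arc joins a new vertex to an earlier one. The trees in \<open>S V E n\<close> are
  exactly those given by growing lists with edges in the graph (\<open>tree_of_in_S\<close>,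
  \<open>is_tree_of\<close>), and each of these is the pioneer tree of a finite walk (\<open>growing_is_pioneers\<close>): between two discoveries the walk
  retraces its steps. Since every state is the tree of a walk, moves stay in \<open>S V E n\<close>, and to
  reach \<open>t\<close> from \<open>s\<close> one prepends, step by step, a walk with tree \<open>t\<close> and a connection to the
  walk of \<open>s\<close>. Hence irreducibility (\<open>K_irreducible\<close>), and with it uniqueness and full support.

  The pioneer tree depends on a random and unbounded number of steps, so invariance is
  obtained as a limit over finite horizons. Among the trajectories of length \<open>N + 1\<close>, those with
  fewer than \<open>n\<close> vertices have a total weight \<open>short_mass n N\<close>. Up to this error, one step of the
  kernel leads from the tree law at horizon \<open>N\<close> to the one at horizon \<open>N + 1\<close>
  (\<open>tree_mass_step\<close>), and both are close to the law of the pioneer tree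
  (\<open>prt_law_tree_mass\<close>). The error vanishes because, by the maximum principle, the probability of
  avoiding a given vertex forever is zero (\<open>avoid_tendsto_0\<close>).
\<close>

section \<open>Recursive trees as lists of arcs\<close>

text \<open>Each arc \<open>(a, b)\<close> adds the vertex \<open>a\<close> and attaches it to a vertex \<open>b\<close> that is already present.\<close>

definition growing :: "'v \<Rightarrow> ('v \<times> 'v) list \<Rightarrow> bool" where
  "growing r al \<longleftrightarrow> distinct (r # map fst al) \<and>
     (\<forall>i<length al. snd (al ! i) \<in> insert r (fst ` set (take i al)))"

definition numbering :: "'a list \<Rightarrow> 'a \<rightharpoonup> nat" where
  "numbering al = map_of (zip al [1..<Suc (length al)])"

definition tree_of :: "'v \<Rightarrow> ('v \<times> 'v) list \<Rightarrow> 'v ltree" where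
  "tree_of r al = (((insert r (fst ` set al), set al), r), numbering al)"

lemma growing_Nil [simp]: "growing r []"
  by (simp add: growing_def)

lemma growing_snoc:
  "growing r (al @ [(a, p)]) \<longleftrightarrow>
     growing r al \<and> a \<notin> insert r (fst ` set al) \<and> p \<in> insert r (fst ` set al)"
  unfolding growing_def
  by (auto simp: less_Suc_eq nth_append)

lemma growing_take: "growing r al \<Longrightarrow> growing r (take k al)"
  unfolding growing_def
  by (auto simp: take_map[symmetric] min_def dest: in_set_takeD)

lemma growing_distinct: "growing r al \<Longrightarrow> distinct al"
  unfolding growing_def by (auto simp: distinct_map)

lemma growing_card: "growing r al \<Longrightarrow> card (insert r (fst ` set al)) = Suc (length al)"
  unfolding growing_def
  by (metis distinct_card image_set list.simps(15) length_map list.size(4) add.right_neutral add_Suc_right)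

lemma growing_fst_inj:
  "growing r al \<Longrightarrow> (a, b) \<in> set al \<Longrightarrow> (a, c) \<in> set al \<Longrightarrow> b = c"
  unfolding growing_def by (auto intro: eq_key_imp_eq_value[of al])

lemma growing_root: "growing r al \<Longrightarrow> (r, b) \<notin> set al"
  unfolding growing_def by (auto simp: image_iff)

lemma growing_snd: "growing r al \<Longrightarrow> (a, b) \<in> set al \<Longrightarrow> b \<in> insert r (fst ` set al)"
proof -
  assume g: "growing r al" and "(a, b) \<in> set al"
  then obtain i where "i < length al" "al ! i = (a, b)" by (auto simp: in_set_conv_nth)
  then have "b \<in> insert r (fst ` set (take i al))"
    using g unfolding growing_def by (metis snd_conv)
  then show ?thesis using set_take_subset[of i al] by blast
qed

lemma growing_reaches_root:
  "growing r al \<Longrightarrow> u \<in> insert r (fst ` set al) \<Longrightarrow> (u, r) \<in> (set al)\<^sup>*"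
proof (induction al arbitrary: u rule: rev_induct)
  case Nil
  then show ?case by simp
next
  case (snoc f al)
  obtain a p where f: "f = (a, p)" by force
  have g: "growing r al" "p \<in> insert r (fst ` set al)"
    using snoc.prems(1) by (auto simp: f growing_snoc)
  have old: "(x, r) \<in> (set (al @ [f]))\<^sup>*" if "x \<in> insert r (fst ` set al)" for x
    using snoc.IH[OF g(1) that] rtrancl_mono[of "set al" "set (al @ [f])"] by auto
  show ?case
  proof (cases "u = a")
    case True
    have "(a, p) \<in> set (al @ [f])" by (simp add: f)
    then show ?thesis using old[OF g(2)] True by (meson converse_rtrancl_into_rtrancl)
  next
    case False
    then show ?thesis using old snoc.prems(2) by (auto simp: f)
  qed
qed

lemma growing_asym: "growing r al \<Longrightarrow> (a, b) \<in> set al \<Longrightarrow> (b, a) \<notin> set al"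
proof (induction al rule: rev_induct)
  case (snoc f al)
  obtain x p where f: "f = (x, p)" by force
  have g: "growing r al" and x: "x \<notin> insert r (fst ` set al)" "x \<noteq> p"
    using snoc.prems(1) by (auto simp: f growing_snoc)
  have "(y, x) \<notin> set al" "(x, y) \<notin> set al" for y
    using growing_snd[OF g, of y x] x(1) by force+
  then show ?case using snoc.IH[OF g] snoc.prems(2) x(2) unfolding f by auto
qed simp

text \<open>Every arc goes from a vertex to an earlier one, so an initial segment of the vertices cannot be
  left along arcs.\<close>

lemma growing_closed:
  assumes "growing r al" "(a, b) \<in> set al" "a \<in> insert r (fst ` set (take i al))"
  shows "b \<in> insert r (fst ` set (take i al))"
proof -
  have "a \<noteq> r" using assms growing_root by metis
  then obtain c where c: "(a, c) \<in> set (take i al)" using assms(3) by auto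
  then have "c = b" using growing_fst_inj[OF assms(1)] assms(2) by (meson in_set_takeD)
  then show ?thesis using growing_snd[OF growing_take[OF assms(1)] c] by simp
qed

text \<open>The two neighbours of a vertex are found by rotating the cycle so that it starts there.\<close>

lemma cycle_neighbours:
  assumes "is_cycle F p" "x \<in> set p" "length p \<noteq> 1"
  obtains y z where "y \<noteq> z" "{x, y} \<in> F" "{x, z} \<in> F"
proof -
  obtain ys zs where p: "p = ys @ x # zs" using assms(2) by (meson split_list)
  have len: "length (zs @ ys) \<ge> 2"
    using assms unfolding is_cycle_def p by (cases zs; cases ys; auto simp: Suc_le_eq)
  have suc: "successively (\<lambda>a b. {a, b} \<in> F) (ys @ x # zs)" and cl: "{last p, hd p} \<in> F"
    and dist: "distinct (ys @ x # zs)"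
    using assms(1) by (auto simp: is_cycle_def p)
  have "{x, hd (zs @ ys)} \<in> F"
    using suc cl len by (cases zs) (auto simp: p successively_append_iff hd_append split: if_splits)
  moreover have "{x, last (zs @ ys)} \<in> F"
    using suc cl len
    by (cases ys rule: rev_cases) (auto simp: p successively_append_iff insert_commute split: if_splits)
  moreover have "hd (zs @ ys) \<noteq> last (zs @ ys)"
  proof -
    have "distinct (zs @ ys)" using dist by auto
    then show ?thesis using len
      by (cases "zs @ ys") (auto split: if_splits)
  qed
  ultimately show ?thesis using that by blast
qed

text \<open>The vertex added last has a single neighbour, so it lies on no cycle and can be removed.\<close>

lemma growing_acyclic: "growing r al \<Longrightarrow> \<not> is_cycle (undirected (set al)) p"
proof (induction al rule: rev_induct)
  case Nil
  then show ?case by (auto simp: is_cycle_def undirected_def)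
next
  case (snoc f al)
  obtain a q where f: "f = (a, q)" by force
  have g: "growing r al" and a: "a \<notin> insert r (fst ` set al)" and q: "q \<in> insert r (fst ` set al)"
    using snoc.prems by (auto simp: f growing_snoc)
  let ?F = "undirected (set al)"
  have fresh: "{a, y} \<notin> ?F" for y
    using a growing_snd[OF g] by (force simp: undirected_def doubleton_eq_iff)
  have only: "y = q" if "{a, y} \<in> undirected (set (al @ [f]))" for y
    using that fresh[of y] by (auto simp: undirected_def f doubleton_eq_iff)
  show ?case
  proof
    assume c: "is_cycle (undirected (set (al @ [f]))) p"
    have "a \<notin> set p"
    proof
      assume ap: "a \<in> set p"
      show False
      proof (cases "length p = 1")
        case True
        then have "p = [a]" using ap by (cases p) auto
        then have "{a, a} \<in> undirected (set (al @ [f]))" using c by (auto simp: is_cycle_def)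
        then show False using only q a by blast
      next
        case False
        then show False using cycle_neighbours[OF c ap] only by metis
      qed
    qed
    then have old: "{x, y} \<in> ?F" if "x \<in> set p" "y \<in> set p" "{x, y} \<in> undirected (set (al @ [f]))" for x y
      using that by (auto simp: undirected_def f doubleton_eq_iff)
    have "is_cycle ?F p"
      using c old unfolding is_cycle_def
      by (auto intro: successively_mono[of "\<lambda>a b. {a, b} \<in> undirected (set (al @ [f]))"])
    then show False using snoc.IH[OF g] by blast
  qed
qed

lemma numbering_nth: "distinct al \<Longrightarrow> i < length al \<Longrightarrow> numbering al (al ! i) = Some (Suc i)"
proof -
  assume d: "distinct al" and i: "i < length al"
  have "(al ! i, Suc i) \<in> set (zip al [1..<Suc (length al)])"
    using i by (auto simp: set_zip intro!: exI[of _ i] simp del: upt_Suc)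
  then show ?thesis unfolding numbering_def using d
    by (intro map_of_is_SomeI) (auto simp del: upt_Suc)
qed

lemma numbering_dom: "dom (numbering al) = set al"
  unfolding numbering_def by (subst dom_map_of_zip) (auto simp del: upt_Suc)

lemma numbering_None: "f \<notin> set al \<Longrightarrow> numbering al f = None"
  using numbering_dom[of al] by (auto simp: dom_def)

lemma numbering_Some_iff:
  "distinct al \<Longrightarrow> numbering al f = Some k \<longleftrightarrow> (\<exists>i<length al. f = al ! i \<and> k = Suc i)"
proof
  assume d: "distinct al" and "numbering al f = Some k"
  then have "f \<in> set al" using numbering_dom[of al] by (auto simp: dom_def)
  then obtain i where "i < length al" "f = al ! i" by (auto simp: in_set_conv_nth)
  then show "\<exists>i<length al. f = al ! i \<and> k = Suc i"
    using numbering_nth[OF d] \<open>numbering al f = Some k\<close> by auto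
qed (auto simp: numbering_nth)

lemma numbering_ran: "distinct al \<Longrightarrow> ran (numbering al) = {1..length al}"
proof -
  assume d: "distinct al"
  have "k \<in> ran (numbering al) \<longleftrightarrow> k \<in> {1..length al}" for k
    unfolding ran_def mem_Collect_eq numbering_Some_iff[OF d]
    by (cases k) (auto simp: Suc_le_eq)
  then show ?thesis by blast
qed

lemma numbering_eqI:
  assumes "distinct al" "\<And>f. f \<notin> set al \<Longrightarrow> l f = None"
    and "\<And>i. i < length al \<Longrightarrow> l (al ! i) = Some (Suc i)"
  shows "l = numbering al"
proof
  fix f
  show "l f = numbering al f"
    using assms by (cases "f \<in> set al") (auto simp: in_set_conv_nth numbering_nth numbering_None)
qed

text \<open>A vertex must have been added, by its own outgoing arc, before another vertex can be attached
  to it.\<close>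

lemma growing_label_less:
  assumes "growing r al" "(a, b) \<in> set al" "(b, c) \<in> set al"
  shows "the (numbering al (b, c)) < the (numbering al (a, b))"
proof -
  have d: "distinct al" using assms(1) by (rule growing_distinct)
  obtain i where i: "i < length al" "al ! i = (a, b)" using assms(2) by (auto simp: in_set_conv_nth)
  obtain j where j: "j < length al" "al ! j = (b, c)" using assms(3) by (auto simp: in_set_conv_nth)
  have "b \<noteq> r" using assms growing_root by metis
  moreover have "b \<in> insert r (fst ` set (take i al))"
    using assms(1) i unfolding growing_def by (metis snd_conv)
  ultimately obtain c' where c': "(b, c') \<in> set (take i al)" by auto
  then have "c' = c" using growing_fst_inj[OF assms(1)] assms(3) by (meson in_set_takeD)
  with c' obtain k where k: "k < i" "al ! k = (b, c)"
    using i by (auto simp: in_set_conv_nth)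
  then have "k = j" using d i j nth_eq_iff_index_eq[OF d, of k j] by simp
  then show ?thesis using k i j numbering_nth[OF d, of i] numbering_nth[OF d, of j] by simp
qed

lemma growing_decreasing: "growing r al \<Longrightarrow> decreasing_labels (set al) r (numbering al)"
proof -
  assume g: "growing r al"
  have "sorted_wrt (>) (map (\<lambda>f. the (numbering al f)) (zip p (tl p)))"
    if "successively (\<lambda>a b. (a, b) \<in> set al) p" for p
  proof -
    have "successively (>) (map (\<lambda>f. the (numbering al f)) (zip p (tl p)))"
      using that
    proof (induction p rule: induct_list012)
      case (3 x y zs)
      then show ?case using growing_label_less[OF g] by (cases zs) auto
    qed auto
    then show ?thesis by (subst (asm) successively_conv_sorted_wrt) (auto simp: transp_def)
  qed
  then show ?thesis unfolding decreasing_labels_def by blast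
qed

lemma tree_of_in_S:
  assumes g: "growing r al" and "r \<in> V" "undirected (set al) \<subseteq> E" "fst ` set al \<subseteq> V"
  shows "tree_of r al \<in> S V E (Suc (length al))"
proof -
  let ?U = "insert r (fst ` set al)" and ?R = "{(x, y). {x, y} \<in> undirected (set al)}"
  have "sym ?R" by (auto simp: sym_def insert_commute)
  have sub: "set al \<subseteq> ?R" by (auto simp: undirected_def)
  have "(a, b) \<in> ?R\<^sup>*" if "a \<in> ?U" "b \<in> ?U" for a b
  proof -
    have *: "(x, r) \<in> ?R\<^sup>*" if "x \<in> ?U" for x
      using growing_reaches_root[OF g that] rtrancl_mono[OF sub] by blast
    then show ?thesis using that \<open>sym ?R\<close> by (meson rtrancl_trans sym_rtrancl symD)
  qed
  moreover have "graph_on ?U (undirected (set al))"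
    using growing_snd[OF g] by (force simp: graph_on_def undirected_def)
  ultimately have "connected_graph ?U (undirected (set al))"
    by (auto simp: connected_graph_def)
  then have "is_tree ?U (undirected (set al))"
    using growing_acyclic[OF g] by (auto simp: is_tree_def)
  then have "rooted_tree ?U (set al) r"
    using growing_asym[OF g] growing_reaches_root[OF g] by (auto simp: rooted_tree_def)
  then show ?thesis
    unfolding tree_of_def S_def
    using assms growing_card[OF g] numbering_dom[of al] numbering_ran[OF growing_distinct[OF g]]
      growing_decreasing[OF g]
    by auto
qed

section \<open>The first-entrance arcs of a finite trajectory\<close>

text \<open>The arcs \<open>(x, p)\<close> where \<open>p\<close> is the position just before the first visit to \<open>x\<close>, in the order
  of these visits. The recursion prepends a step, which is the operation performed by the
  kernel; \<open>pioneers_snoc\<close> gives the description forward in time.\<close>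

fun pioneers :: "'v list \<Rightarrow> ('v \<times> 'v) list" where
  "pioneers [] = []"
| "pioneers [r] = []"
| "pioneers (v # r # xs) =
     (if v = r then pioneers (r # xs)
      else (r, v) # filter (\<lambda>f. fst f \<noteq> v) (pioneers (r # xs)))"

definition pioneer_tree :: "nat \<Rightarrow> 'v list \<Rightarrow> 'v ltree" where
  "pioneer_tree n xs = tree_of (hd xs) (take (n - 1) (pioneers xs))"

text \<open>In the case where \<open>a\<close> is the starting point, prepending it removes the arc that its later visit
  had produced.\<close>

lemma pioneers_snoc:
  "xs \<noteq> [] \<Longrightarrow>
   pioneers (xs @ [a]) = (if a \<in> set xs then pioneers xs else pioneers xs @ [(a, last xs)])"
proof (induction xs rule: pioneers.induct)
  case (3 v r xs)
  then show ?case by (cases "v = r") auto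
qed auto

lemma pioneers_append: "xs \<noteq> [] \<Longrightarrow> \<exists>zs. pioneers (xs @ ys) = pioneers xs @ zs"
proof (induction ys rule: rev_induct)
  case (snoc y ys)
  then show ?case using pioneers_snoc[of "xs @ ys" y] by auto
qed simp

lemma set_pioneers: "xs \<noteq> [] \<Longrightarrow> insert (hd xs) (fst ` set (pioneers xs)) = set xs"
proof (induction xs rule: rev_nonempty_induct)
  case (snoc x xs)
  then show ?case by (auto simp: pioneers_snoc)
qed simp

lemma growing_pioneers: "xs \<noteq> [] \<Longrightarrow> growing (hd xs) (pioneers xs)"
proof (induction xs rule: rev_nonempty_induct)
  case (snoc x xs)
  then show ?case by (simp add: pioneers_snoc growing_snoc set_pioneers)
qed simp

lemma card_pioneers: "xs \<noteq> [] \<Longrightarrow> card (set xs) = Suc (length (pioneers xs))"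
  using growing_card[OF growing_pioneers] set_pioneers by metis

lemma pioneers_edges:
  "xs \<noteq> [] \<Longrightarrow> successively (\<lambda>a b. {a, b} \<in> E) xs \<Longrightarrow> undirected (set (pioneers xs)) \<subseteq> E"
proof (induction xs rule: rev_nonempty_induct)
  case (snoc x xs)
  then show ?case
    by (auto simp: pioneers_snoc undirected_def successively_append_iff insert_commute)
qed (simp add: undirected_def)

lemma pioneers_inside: "xs \<noteq> [] \<Longrightarrow> set ys \<subseteq> set xs \<Longrightarrow> pioneers (xs @ ys) = pioneers xs"
proof (induction ys rule: rev_induct)
  case (snoc y ys)
  then show ?case using pioneers_snoc[of "xs @ ys" y] by auto
qed simp

lemma pioneer_tree_append:
  "xs \<noteq> [] \<Longrightarrow> n \<le> card (set xs) \<Longrightarrow> pioneer_tree n (xs @ ys) = pioneer_tree n xs"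
  using pioneers_append[of xs ys] card_pioneers[of xs] by (auto simp: pioneer_tree_def)

lemma pioneer_tree_in_S:
  assumes "xs \<noteq> []" "set xs \<subseteq> V" "successively (\<lambda>a b. {a, b} \<in> E) xs"
    and "1 \<le> n" "n \<le> card (set xs)"
  shows "pioneer_tree n xs \<in> S V E n"
proof -
  let ?al = "take (n - 1) (pioneers xs)"
  have "Suc (length ?al) = n" using card_pioneers[of xs] assms by auto
  moreover have "growing (hd xs) ?al" using growing_take[OF growing_pioneers] assms by blast
  moreover have "undirected (set ?al) \<subseteq> E"
    using pioneers_edges[of xs E] assms set_take_subset[of "n - 1" "pioneers xs"]
    unfolding undirected_def by blast
  moreover have "fst ` set ?al \<subseteq> V"
    using set_pioneers[of xs] assms set_take_subset[of "n - 1" "pioneers xs"] by blast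
  moreover have "hd xs \<in> V" using assms by auto
  ultimately show ?thesis using tree_of_in_S[of "hd xs" ?al V E] by (simp add: pioneer_tree_def)
qed

lemma root_pioneer_tree: "root (pioneer_tree n xs) = hd xs"
  by (simp add: pioneer_tree_def tree_of_def root_def)

text \<open>Edges can be used in both directions, so it suffices to retrace the walk backward from its end
  up to \<open>p\<close>.\<close>

lemma return_walk:
  assumes "successively (\<lambda>a b. {a, b} \<in> E) xs" "p \<in> set xs"
  obtains ys where "successively (\<lambda>a b. {a, b} \<in> E) (xs @ ys)" "set ys \<subseteq> set xs" "last (xs @ ys) = p"
proof -
  obtain us vs where xs: "xs = us @ p # vs" using assms(2) by (meson split_list)
  show ?thesis
  proof (rule that)
    have s: "successively (\<lambda>a b. {a, b} \<in> E) (p # vs)"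
      using assms(1) unfolding xs by (simp add: successively_append_iff)
    then have "successively (\<lambda>a b. {a, b} \<in> E) (rev (p # vs))"
      by (subst successively_rev) (simp add: insert_commute)
    then have "successively (\<lambda>a b. {a, b} \<in> E) (tl (rev (p # vs)))"
      and "tl (rev (p # vs)) \<noteq> [] \<Longrightarrow> {last xs, hd (tl (rev (p # vs)))} \<in> E"
      unfolding xs by (cases vs rule: rev_cases; simp add: successively_Cons)+
    then show "successively (\<lambda>a b. {a, b} \<in> E) (xs @ tl (rev (p # vs)))"
      using assms(1) by (auto simp: successively_append_iff)
    show "set (tl (rev (p # vs))) \<subseteq> set xs"
      using list.set_sel(2)[of "rev (p # vs)"] unfolding xs by auto
    show "last (xs @ tl (rev (p # vs))) = p"
      unfolding xs by (cases vs rule: rev_cases) auto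
  qed
qed

text \<open>The arcs are discovered one after the other: before each new arc the walk returns to the
  endpoint of that arc through vertices it knows, which produces no other arc.\<close>

lemma growing_is_pioneers:
  assumes "growing r al" "undirected (set al) \<subseteq> E"
  obtains xs where "xs \<noteq> []" "hd xs = r" "successively (\<lambda>a b. {a, b} \<in> E) xs" "pioneers xs = al"
proof -
  have "\<exists>xs. xs \<noteq> [] \<and> hd xs = r \<and> successively (\<lambda>a b. {a, b} \<in> E) xs \<and> pioneers xs = al"
    using assms
  proof (induction al rule: rev_induct)
    case Nil
    show ?case by (rule exI[of _ "[r]"]) simp
  next
    case (snoc f al)
    obtain a p where f: "f = (a, p)" by force
    have g: "growing r al" "a \<notin> insert r (fst ` set al)" "p \<in> insert r (fst ` set al)"
      using snoc.prems by (auto simp: f growing_snoc)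
    obtain xs where xs: "xs \<noteq> []" "hd xs = r" "successively (\<lambda>a b. {a, b} \<in> E) xs" "pioneers xs = al"
      using snoc.IH[OF g(1)] snoc.prems(2) by (auto simp: undirected_def)
    have set_xs: "set xs = insert r (fst ` set al)" using set_pioneers[of xs] xs by simp
    obtain ys where ys: "successively (\<lambda>a b. {a, b} \<in> E) (xs @ ys)" "set ys \<subseteq> set xs"
        "last (xs @ ys) = p"
      using return_walk[OF xs(3), of p] g(3) set_xs by metis
    have "pioneers (xs @ ys @ [a]) = al @ [(a, p)]"
      using pioneers_snoc[of "xs @ ys" a] pioneers_inside[OF xs(1) ys(2)] xs ys g(2) set_xs by auto
    moreover have "successively (\<lambda>a b. {a, b} \<in> E) (xs @ ys @ [a])"
      using ys snoc.prems(2) xs(1) successively_append_iff[of _ "xs @ ys" "[a]"]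
      by (simp add: undirected_def f insert_commute)
    ultimately show ?case using xs by (intro exI[of _ "xs @ ys @ [a]"]) (simp add: f)
  qed
  then show ?thesis using that by blast
qed

section \<open>Pioneer trees of infinite trajectories\<close>

text \<open>The number of visited vertices grows by at most one in each step, so it skips no value.\<close>

lemma hitting_le:
  assumes "card (w ` {0..N}) \<ge> k" "k \<ge> 1"
  shows "card (w ` {0..hitting w k}) = k" "hitting w k \<le> N"
proof -
  have "\<exists>j\<le>N. card (w ` {0..j}) = k"
    using assms
  proof (induction N)
    case 0
    then show ?case by (intro exI[of _ 0]) simp
  next
    case (Suc N)
    show ?case
    proof (cases "k \<le> card (w ` {0..N})")
      case True
      then show ?thesis using Suc by (meson le_SucI)
    next
      case False
      have "w ` {0..Suc N} = insert (w (Suc N)) (w ` {0..N})" by (simp add: atLeast0_atMost_Suc)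
      then have "card (w ` {0..Suc N}) \<le> Suc (card (w ` {0..N}))"
        by (metis card_insert_le_m1 card_insert_if finite_imageI finite_atLeastAtMost le_SucI order_refl)
      then show ?thesis using False Suc.prems by (intro exI[of _ "Suc N"]) auto
    qed
  qed
  then obtain j where j: "j \<le> N" "card (w ` {0..j}) = k" by blast
  have "hitting w k = (LEAST j. card (w ` {0..j}) = k)"
    unfolding hitting_def Inf_nat_def using j by auto
  then show "card (w ` {0..hitting w k}) = k" "hitting w k \<le> N"
    using j LeastI[of "\<lambda>j. card (w ` {0..j}) = k" j] Least_le[of "\<lambda>j. card (w ` {0..j}) = k" j]
    by auto
qed

lemma pioneers_nth:
  assumes "2 \<le> k" "k \<le> card (w ` {0..N})"
  shows "pioneers (map w [0..<Suc N]) ! (k - 2) = (w (hitting w k), w (hitting w k - 1))"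
  using assms
proof (induction N)
  case 0
  then show ?case by simp
next
  case (Suc N)
  let ?xs = "map w [0..<Suc N]"
  have set_xs: "set ?xs = w ` {0..N}" by (simp only: set_map set_upt atLeastLessThanSuc_atLeastAtMost)
  have ne: "?xs \<noteq> []" and last: "last ?xs = w N" by simp_all
  have step: "pioneers (map w [0..<Suc (Suc N)]) =
      (if w (Suc N) \<in> w ` {0..N} then pioneers ?xs else pioneers ?xs @ [(w (Suc N), w N)])"
    using pioneers_snoc[OF ne, of "w (Suc N)"] unfolding set_xs last by simp
  have len: "length (pioneers ?xs) = card (w ` {0..N}) - 1"
    using card_pioneers[OF ne] unfolding set_xs by simp
  have img: "w ` {0..Suc N} = insert (w (Suc N)) (w ` {0..N})" by (simp add: atLeast0_atMost_Suc)
  show ?case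
  proof (cases "k \<le> card (w ` {0..N})")
    case True
    then show ?thesis using Suc step len by (auto simp: nth_append)
  next
    case False
    then have new: "w (Suc N) \<notin> w ` {0..N}" and k: "k = Suc (card (w ` {0..N}))"
      using Suc.prems(2) unfolding img by (auto simp: card_insert_if split: if_splits)
    have "\<not> hitting w k \<le> N"
    proof
      assume "hitting w k \<le> N"
      then have "card (w ` {0..hitting w k}) \<le> card (w ` {0..N})"
        by (intro card_mono image_mono) auto
      then show False using hitting_le(1)[of k w "Suc N"] Suc.prems k by simp
    qed
    then have "hitting w k = Suc N" using hitting_le(2)[of k w "Suc N"] Suc.prems by simp
    then show ?thesis using step new len k Suc.prems(1) by (simp add: nth_append)
  qed
qed

lemma prt_eq_pioneer_tree:
  assumes "1 \<le> n" "n \<le> card (w ` {0..N})"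
  shows "prt n w = pioneer_tree n (map w [0..<Suc N])"
proof -
  define arc where "arc k = (w (hitting w k), w (hitting w k - 1))" for k
  let ?xs = "map w [0..<Suc N]" and ?h = "hitting w n"
  let ?ys = "map w [0..<Suc ?h]"
  let ?al = "take (n - 1) (pioneers ?xs)"
  have set_map': "set (map w [0..<Suc j]) = w ` {0..j}" for j
    by (simp only: set_map set_upt atLeastLessThanSuc_atLeastAtMost)
  have hd': "hd (map w [0..<Suc j]) = w 0" and ne: "map w [0..<Suc j] \<noteq> []" for j
    by (simp_all add: hd_map del: upt_Suc)
  have card_xs: "Suc (length (pioneers ?xs)) = card (w ` {0..N})"
    using card_pioneers[OF ne] unfolding set_map' by simp
  have al: "?al = map arc [2..<n + 1]"
  proof (rule nth_equalityI)
    show "length ?al = length (map arc [2..<n + 1])"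
      using card_xs assms by (simp del: upt_Suc; arith)
    fix i assume "i < length ?al"
    then show "?al ! i = map arc [2..<n + 1] ! i"
      using pioneers_nth[of "i + 2" w N] card_xs assms by (simp add: arc_def del: upt_Suc)
  qed
  have h: "?h \<le> N" "card (w ` {0..?h}) = n" using hitting_le[of n w N] assms by auto
  have "?xs = ?ys @ map w [Suc ?h..<Suc N]"
    using h(1) by (metis Suc_le_mono le_add_diff_inverse map_append upt_add_eq_append zero_le)
  then obtain zs where zs: "pioneers ?xs = pioneers ?ys @ zs"
    using pioneers_append[OF ne] by metis
  have "length (pioneers ?ys) = n - 1"
    using card_pioneers[OF ne[of ?h]] unfolding set_map' h by simp
  then have "?al = pioneers ?ys" using zs by simp
  then have vs: "insert (w 0) (fst ` set ?al) = w ` {0..?h}"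
    using set_pioneers[OF ne[of ?h]] unfolding hd' set_map' by simp
  have "zip (map arc [2..<n + 1]) [1..<Suc (length (map arc [2..<n + 1]))] = map (\<lambda>k. (arc k, k - 1)) [2..<n + 1]"
    using assms(1) by (intro nth_equalityI) (auto simp del: upt_Suc)
  then have "numbering ?al = map_of (map (\<lambda>k. (arc k, k - 1)) [2..<n + 1])"
    unfolding numbering_def al by (simp only:)
  moreover have "arc ` {2..n} = set ?al" unfolding al by (auto simp del: upt_Suc)
  ultimately show ?thesis
    unfolding prt_def pioneer_tree_def tree_of_def Let_def hd' vs arc_def[symmetric] by simp
qed

section \<open>The kernel moves prepend a step\<close>

lemma filter_fst_neq_id: "v \<notin> fst ` set al \<Longrightarrow> filter (\<lambda>f. fst f \<noteq> v) al = al"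
  by (induction al) auto

lemma move_root: "move (tree_of r al) r = tree_of r al"
  by (simp add: move_def tree_of_def)

lemma growing_Cons_filter:
  assumes g: "growing r al" and "v \<noteq> r"
  shows "growing v ((r, v) # filter (\<lambda>f. fst f \<noteq> v) al)"
  using g
proof (induction al rule: rev_induct)
  case Nil
  then show ?case using assms(2) growing_snoc[of v "[]" r v] by simp
next
  case (snoc f al)
  obtain a p where f: "f = (a, p)" by force
  have g: "growing r al" "a \<notin> insert r (fst ` set al)" "p \<in> insert r (fst ` set al)"
    using snoc.prems by (auto simp: f growing_snoc)
  show ?case
    using snoc.IH[OF g(1)] g(2,3) growing_snoc[of v "(r, v) # filter (\<lambda>f. fst f \<noteq> v) al" a p]
    by (auto simp: f)
qed

text \<open>The arc \<open>(v, p)\<close> leaving \<open>v\<close> lies on the cycle and has its maximal label. Indeed, let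
  \<open>(x, q)\<close> be an arc with a larger label. The vertices that precede \<open>x\<close> include \<open>q\<close> and \<open>v\<close>,
  so they cannot be left even if the new arc \<open>(r, v)\<close> is used, and \<open>(x, q)\<close> is on no directed
  cycle. After the removal of \<open>(v, p)\<close> everything points toward \<open>v\<close>, so \<open>orient\<close> reverses
  nothing.\<close>

lemma move_known_vertex:
  assumes g: "growing r al" and v: "v \<in> fst ` set al"
  shows "move (tree_of r al) v = tree_of v ((r, v) # filter (\<lambda>f. fst f \<noteq> v) al)"
proof -
  have d: "distinct al" using g by (rule growing_distinct)
  obtain p where "(v, p) \<in> set al" using v by auto
  then obtain al1 al2 where al: "al = al1 @ (v, p) # al2" by (meson split_list)
  have vr: "v \<noteq> r" and fst_dist: "distinct (map fst al)" using g v by (auto simp: growing_def)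
  have filt: "filter (\<lambda>f. fst f \<noteq> v) al = al1 @ al2"
    using fst_dist unfolding al by (auto simp: filter_fst_neq_id)
  let ?nl = "(r, v) # al1 @ al2" and ?l0 = "(numbering al)((r, v) \<mapsto> 0)"
  let ?B = "insert (r, v) (set al)" and ?m = "Suc (length al1)"
  have gn: "growing v ?nl" using growing_Cons_filter[OF g vr] unfolding filt .
  have dn: "distinct ?nl" using gn by (rule growing_distinct)
  have rv: "(r, v) \<notin> set al" using growing_root[OF g] .
  have l_vp: "numbering al (v, p) = Some ?m"
    using numbering_nth[OF d, of "length al1"] unfolding al by simp
  have C_le: "k \<le> ?m" if "f \<in> cycle_arcs ?B" "?l0 f = Some k" for f k
  proof (rule ccontr)
    assume "\<not> k \<le> ?m"
    then have "f \<noteq> (r, v)" and "numbering al f = Some k" using that(2) by (auto split: if_splits)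
    then obtain i where i: "i < length al" "f = al ! i" "k = Suc i"
      using numbering_Some_iff[OF d] by blast
    obtain x q where f: "f = (x, q)" by force
    let ?W = "insert r (fst ` set (take i al))"
    \<comment> \<open>As the label is larger than the one of the arc of v, the vertex v precedes x.\<close>
    have "(v, p) \<in> set (take i al)"
      using \<open>\<not> k \<le> ?m\<close> i(3) unfolding al by (cases "i - length al1") auto
    then have "v \<in> ?W" by force
    have W: "b \<in> ?W" if "(a, b) \<in> ?B" "a \<in> ?W" for a b
      using growing_closed[OF g _ that(2)] that(1) \<open>v \<in> ?W\<close> by blast
    have "(q, x) \<in> ?B\<^sup>*" using that(1) by (simp add: cycle_arcs_def f)
    moreover have "q \<in> ?W" using g i f unfolding growing_def by (metis snd_conv)
    ultimately have "x \<in> ?W"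
      by (induction rule: rtrancl_induct) (use W in blast)+
    moreover have "x \<notin> ?W"
    proof -
      have "take (Suc i) al = take i al @ [(x, q)]" using i f by (metis take_Suc_conv_app_nth)
      then have "growing r (take i al @ [(x, q)])" using growing_take[OF g, of "Suc i"] by simp
      then show ?thesis by (simp add: growing_snoc)
    qed
    ultimately show False by blast
  qed
  have C_vp: "(v, p) \<in> cycle_arcs ?B"
  proof -
    have "(p, r) \<in> (set al)\<^sup>*"
      using growing_reaches_root[OF g] growing_snd[OF g] \<open>(v, p) \<in> set al\<close> by blast
    then have "(p, r) \<in> ?B\<^sup>*" using rtrancl_mono[of "set al" ?B] by blast
    then have "(p, v) \<in> ?B\<^sup>*" by (meson insertI1 rtrancl.rtrancl_into_rtrancl)
    then show ?thesis using \<open>(v, p) \<in> set al\<close> by (simp add: cycle_arcs_def)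
  qed
  have Max: "Max {k. \<exists>f\<in>cycle_arcs ?B. ?l0 f = Some k} = ?m"
  proof (rule Max_eqI)
    show upper: "k \<le> ?m" if k: "k \<in> {k. \<exists>f\<in>cycle_arcs ?B. ?l0 f = Some k}" for k
    proof -
      from k obtain f where "f \<in> cycle_arcs ?B" "?l0 f = Some k" by (simp only: mem_Collect_eq) (erule bexE)
      then show ?thesis by (rule C_le)
    qed
    then show "finite {k. \<exists>f\<in>cycle_arcs ?B. ?l0 f = Some k}"
      by (meson atMost_iff finite_atMost finite_subset subsetI)
    have "?l0 (v, p) = Some ?m" using l_vp vr by simp
    then show "?m \<in> {k. \<exists>f\<in>cycle_arcs ?B. ?l0 f = Some k}"
      using C_vp by (intro CollectI bexI[of _ "(v, p)"])
  qed
  have D: "{f \<in> ?B. ?l0 f \<noteq> Some ?m} = set ?nl"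
  proof -
    have "numbering al f = Some ?m \<longleftrightarrow> f = (v, p)" for f
      using numbering_Some_iff[OF d, of f ?m] unfolding al by auto
    moreover have "(v, p) \<notin> set (al1 @ al2)" using d unfolding al by simp
    ultimately show ?thesis using vr rv unfolding al by auto
  qed
  have orient: "orient C (set ?nl) v f = f" if "f \<in> set ?nl" for C f
  proof -
    obtain a b where f: "f = (a, b)" by force
    have "(b, v) \<in> (set ?nl)\<^sup>*"
      using growing_reaches_root[OF gn] growing_snd[OF gn] that unfolding f by blast
    then show ?thesis by (simp add: orient_def f)
  qed
  have img: "orient C (set ?nl) v ` set ?nl = set ?nl" for C
  proof -
    have "orient C (set ?nl) v ` set ?nl = (\<lambda>f. f) ` set ?nl"
      by (intro image_cong refl orient)
    then show ?thesis by (simp only: image_ident)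
  qed
  have lab: "(\<lambda>(a, b). if (a, b) \<in> set ?nl
      then map_option (shift_label ?m) (if (a, b) \<in> set ?nl then ?l0 (a, b) else ?l0 (b, a))
      else None) = numbering ?nl"
  proof (rule numbering_eqI[OF dn])
    fix i assume i: "i < length ?nl"
    then have "?nl ! i \<in> set ?nl" by (rule nth_mem)
    moreover have "map_option (shift_label ?m) (?l0 (?nl ! i)) = Some (Suc i)"
    proof (cases i)
      case 0
      then show ?thesis by (simp add: shift_label_def)
    next
      case (Suc j)
      then have j: "j < length (al1 @ al2)" and nth: "?nl ! i = (al1 @ al2) ! j"
        using i by auto
      then have "?nl ! i \<in> set al" using nth_mem[OF j] by (auto simp: al)
      then have "?l0 (?nl ! i) = numbering al (?nl ! i)" using rv by auto
      moreover have "numbering al (?nl ! i) = Some (if j < length al1 then Suc j else Suc (Suc j))"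
      proof (cases "j < length al1")
        case True
        then have "?nl ! i = al ! j" unfolding nth by (simp add: al nth_append)
        then show ?thesis using True numbering_nth[OF d, of j] by (simp add: al)
      next
        case False
        then have "?nl ! i = al ! Suc j" unfolding nth by (simp add: al nth_append Suc_diff_le)
        then show ?thesis using False j numbering_nth[OF d, of "Suc j"] by (simp add: al)
      qed
      ultimately show ?thesis using Suc by (auto simp: shift_label_def)
    qed
    ultimately show "(case ?nl ! i of (a, b) \<Rightarrow> if (a, b) \<in> set ?nl
      then map_option (shift_label ?m) (if (a, b) \<in> set ?nl then ?l0 (a, b) else ?l0 (b, a))
      else None) = Some (Suc i)"
      by (simp only: split_beta prod.collapse if_True)
  qed (simp only: split_beta prod.collapse if_False)
  have U: "insert r (fst ` set al) = insert v (fst ` set ?nl)"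
    by (auto simp: al)
  have "move (tree_of r al) v = move_inside (tree_of r al) v"
    using vr v by (simp add: move_def tree_of_def)
  also have "\<dots> = tree_of v ?nl"
    unfolding tree_of_def move_inside_def Let_def prod.case Max D img lab U ..
  finally show ?thesis unfolding filt .
qed

text \<open>The last arc \<open>(x, p)\<close> of \<open>(r, v) # al\<close> has the maximal label. Its tail \<open>x\<close> is a leaf, as no later
  vertex is attached to it, while \<open>p\<close> is either the new root or has an outgoing arc besides
  \<open>(x, p)\<close>. If \<open>al\<close> is empty, the arc removed is \<open>(r, v)\<close> itself, with label 0.\<close>

lemma move_new_vertex:
  assumes g: "growing r al" and v: "v \<notin> insert r (fst ` set al)"
  shows "move (tree_of r al) v = tree_of v (butlast ((r, v) # al))"
proof -
  have d: "distinct al" using g by (rule growing_distinct)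
  have vr: "v \<noteq> r" using v by auto
  have gB: "growing v ((r, v) # al)"
    using growing_Cons_filter[OF g vr] v by (simp add: filter_fst_neq_id)
  have dB: "distinct ((r, v) # al)" using gB by (rule growing_distinct)
  obtain nl x p where nl: "(r, v) # al = nl @ [(x, p)]" by (metis rev_exhaust list.distinct(1) surj_pair)
  have len: "length nl = length al" using arg_cong[OF nl, of length] by simp
  have B: "insert (r, v) (set al) = set (nl @ [(x, p)])" using arg_cong[OF nl, of set] by simp
  have gn: "growing v nl" and x: "x \<notin> insert v (fst ` set nl)" and p: "p \<in> insert v (fst ` set nl)"
    using gB unfolding nl growing_snoc by auto
  have dn: "distinct nl" using gn by (rule growing_distinct)
  let ?l0 = "(numbering al)((r, v) \<mapsto> 0)" and ?m = "length al"
  have l0: "?l0 ((nl @ [(x, p)]) ! i) = Some i" if "i \<le> length al" for i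
  proof (cases i)
    case 0
    then show ?thesis by (simp add: nl[symmetric])
  next
    case (Suc j)
    then have "al ! j \<in> set al" using that by simp
    then have "al ! j \<noteq> (r, v)" using dB by auto
    then show ?thesis using Suc that numbering_nth[OF d, of j] by (simp add: nl[symmetric])
  qed
  have ran: "ran ?l0 = {0..length al}"
  proof -
    have "numbering al (r, v) = None" using dB by (simp add: numbering_None)
    then show ?thesis using numbering_ran[OF d] by auto
  qed
  have Max: "Max (ran ?l0) = ?m" unfolding ran by (intro Max_eqI) auto
  have D: "{f \<in> insert (r, v) (set al). ?l0 f \<noteq> Some ?m} = set nl"
  proof -
    \<comment> \<open>Counted from 0, the labels are the positions in the list, so only the last arc has the maximal one.\<close>
    have old: "?l0 f \<noteq> Some ?m" if "f \<in> set nl" for f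
    proof -
      obtain i where "i < length nl" "f = nl ! i" using \<open>f \<in> set nl\<close> by (auto simp: in_set_conv_nth)
      then show ?thesis using l0[of i] len by (simp add: nth_append)
    qed
    have last: "\<not> ?l0 (x, p) \<noteq> Some ?m" using l0[of ?m] len by (simp add: nth_append)
    have aux: "{f \<in> set (nl @ [z]). P f} = set nl" if "\<And>f. f \<in> set nl \<Longrightarrow> P f" "\<not> P z" for P z
      using that by auto
    show ?thesis unfolding B by (rule aux[of "\<lambda>f. ?l0 f \<noteq> Some ?m" "(x, p)", OF old last])
  qed
  have xp: "(x, p) \<notin> set nl" using x by force
  have BD: "set (nl @ [(x, p)]) - set nl = {(x, p)}" using xp by auto
  have X: "{y. is_leaf (set (nl @ [(x, p)])) v y \<and> (\<exists>f\<in>{(x, p)}. y = fst f \<or> y = snd f)} = {x}"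
  proof -
    have "{f \<in> set (nl @ [(x, p)]). fst f = x \<or> snd f = x} = {(x, p)}"
      using x growing_snd[OF gn] by force
    then have "is_leaf (set (nl @ [(x, p)])) v x" using x by (simp add: is_leaf_def)
    moreover have "\<not> is_leaf (set (nl @ [(x, p)])) v p"
    proof
      assume leaf: "is_leaf (set (nl @ [(x, p)])) v p"
      then have "p \<noteq> v" by (simp add: is_leaf_def)
      then obtain q where q: "(p, q) \<in> set nl" using p by auto
      have "{(p, q), (x, p)} \<subseteq> {f \<in> set (nl @ [(x, p)]). fst f = p \<or> snd f = p}" using q by auto
      then have "card {(p, q), (x, p)} \<le> card {f \<in> set (nl @ [(x, p)]). fst f = p \<or> snd f = p}"
        by (intro card_mono) auto
      moreover have "(p, q) \<noteq> (x, p)" using q xp by auto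
      ultimately show False using leaf by (simp add: is_leaf_def)
    qed
    ultimately show ?thesis by auto
  qed
  have lab: "(\<lambda>f. if f \<in> set nl then map_option (shift_label ?m) (?l0 f) else None) = numbering nl"
  proof (rule numbering_eqI[OF dn])
    fix i assume i: "i < length nl"
    then show "(if nl ! i \<in> set nl then map_option (shift_label ?m) (?l0 (nl ! i)) else None) = Some (Suc i)"
      using l0[of i] len by (simp add: nth_append shift_label_def)
  qed auto
  have U: "insert v (insert r (fst ` set al)) - {x} = insert v (fst ` set nl)"
  proof -
    have "insert r (fst ` set al) = fst ` set (nl @ [(x, p)])" unfolding B[symmetric] by simp
    then show ?thesis using x by auto
  qed
  have "move (tree_of r al) v = move_outside (tree_of r al) v"
    using v by (simp add: move_def tree_of_def)
  also have "\<dots> = tree_of v nl"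
    unfolding tree_of_def move_outside_def Let_def prod.case Max D
    unfolding B BD X lab U ..
  finally show ?thesis by (simp add: nl)
qed

text \<open>The list must keep its length \<open>n - 1\<close>. If \<open>v \<noteq> r\<close> is among the first \<open>n\<close>
  vertices, its own arc makes room for the new one, and otherwise the last arc does.\<close>

lemma move_pioneer_tree:
  assumes "xs \<noteq> []" "1 \<le> n" "n \<le> card (set xs)"
  shows "move (pioneer_tree n xs) v = pioneer_tree n (v # xs)"
proof -
  obtain r ys where xs: "xs = r # ys" using assms(1) by (cases xs) auto
  let ?al = "take (n - 1) (pioneers xs)" and ?bl = "drop (n - 1) (pioneers xs)"
  let ?P = "\<lambda>f. fst f \<noteq> v"
  have g: "growing r ?al" using growing_take[OF growing_pioneers[OF assms(1)]] xs by simp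
  have len: "length ?al = n - 1" using card_pioneers[OF assms(1)] assms by auto
  have t: "pioneer_tree n xs = tree_of r ?al" by (simp add: pioneer_tree_def xs)
  have split: "filter ?P (pioneers xs) = filter ?P ?al @ filter ?P ?bl"
    by (metis append_take_drop_id filter_append)
  consider "v = r" | "v \<noteq> r" "v \<in> fst ` set ?al" | "v \<noteq> r" "v \<notin> fst ` set ?al" by blast
  then show ?thesis
  proof cases
    case 1
    then show ?thesis unfolding t by (simp add: move_root pioneer_tree_def xs)
  next
    case 2
    then obtain p where "(v, p) \<in> set ?al" by auto
    then obtain al1 al2 where al: "?al = al1 @ (v, p) # al2" by (meson split_list)
    have "distinct (map fst ?al)" using g by (simp add: growing_def)
    then have filt: "filter ?P ?al = al1 @ al2" unfolding al by (auto simp: filter_fst_neq_id)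
    have "Suc (length (al1 @ al2)) = n - 1" using len unfolding al by simp
    then have "take (n - 1) ((r, v) # filter ?P (pioneers xs)) = (r, v) # filter ?P ?al"
      unfolding split filt by (cases "n - 1") auto
    then show ?thesis
      using move_known_vertex[OF g 2(2)] 2(1) unfolding t by (simp add: pioneer_tree_def xs)
  next
    case 3
    have filt: "filter ?P ?al = ?al" using 3(2) by (rule filter_fst_neq_id)
    have "take (n - 1) ((r, v) # filter ?P (pioneers xs)) = butlast ((r, v) # ?al)"
      unfolding split filt using len by (cases "n - 1") (auto simp: butlast_conv_take)
    then show ?thesis
      using move_new_vertex[OF g] 3 unfolding t by (simp add: pioneer_tree_def xs)
  qed
qed

section \<open>Every state is the tree of a growing list\<close>

lemma distinct_path:
  assumes "(a, b) \<in> R\<^sup>*"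
  obtains p where "p \<noteq> []" "hd p = a" "last p = b" "distinct p" "successively (\<lambda>x y. (x, y) \<in> R) p"
proof -
  have "\<exists>p. p \<noteq> [] \<and> hd p = a \<and> last p = b \<and> distinct p \<and> successively (\<lambda>x y. (x, y) \<in> R) p"
    using assms
  proof (induction rule: converse_rtrancl_induct)
    case base
    show ?case by (rule exI[of _ "[b]"]) simp
  next
    case (step a c)
    then obtain p where p: "p \<noteq> []" "hd p = c" "last p = b" "distinct p"
      "successively (\<lambda>x y. (x, y) \<in> R) p" by blast
    show ?case
    proof (cases "a \<in> set p")
      case True
      then obtain ys zs where "p = ys @ a # zs" by (meson split_list)
      then show ?thesis using p by (intro exI[of _ "a # zs"]) (auto simp: successively_append_iff)
    next
      case False
      then show ?thesis using p step(1) by (intro exI[of _ "a # p"]) (auto simp: successively_Cons)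
    qed
  qed
  then show ?thesis using that by blast
qed

text \<open>For \<open>a = u\<close> the detour is empty and the cycle is the loop.\<close>

lemma cycle_of_detour:
  assumes "{a, u} \<in> F" "(a, u) \<in> {(x, y). {x, y} \<in> F - {{a, u}}}\<^sup>*"
  shows "\<exists>p. is_cycle F p"
proof -
  obtain p where p: "p \<noteq> []" "hd p = a" "last p = u" "distinct p"
    "successively (\<lambda>x y. {x, y} \<in> F - {{a, u}}) p"
    using distinct_path[OF assms(2)] by auto
  have "length p \<noteq> 2"
  proof
    assume "length p = 2"
    then obtain x y where "p = [x, y]" by (auto simp: length_Suc_conv numeral_2_eq_2)
    then show False using p by simp
  qed
  moreover have "successively (\<lambda>x y. {x, y} \<in> F) p"
    using p(5) by (rule successively_mono) auto
  ultimately show ?thesis using p assms(1) by (auto simp: is_cycle_def insert_commute)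
qed

text \<open>Whatever the labels, a tree whose arcs all lead to \<open>r\<close> has exactly one arc out of each vertex
  other than \<open>r\<close>. This gives the number of arcs, from which the injectivity of the labels
  follows.\<close>

locale rooted_tree_arcs =
  fixes U :: "'v set" and A r
  assumes rooted: "rooted_tree U A r"
begin

lemma arcs_in: "(a, b) \<in> A \<Longrightarrow> a \<in> U \<and> b \<in> U"
proof -
  assume "(a, b) \<in> A"
  then have "{a, b} \<in> undirected A" by (force simp: undirected_def)
  moreover have "graph_on U (undirected A)"
    using rooted by (simp add: rooted_tree_def is_tree_def connected_graph_def)
  ultimately obtain x y where "x \<in> U" "y \<in> U" "{a, b} = {x, y}"
    unfolding graph_on_def by meson
  then show ?thesis by (auto simp: doubleton_eq_iff)
qed

lemma root_in: "r \<in> U"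
  using rooted unfolding rooted_tree_def by meson

lemma fin: "finite U" "finite A"
proof -
  show U: "finite U" using rooted by (simp add: rooted_tree_def is_tree_def)
  have "A \<subseteq> U \<times> U" by (rule subrelI) (simp add: arcs_in)
  then show "finite A" using U finite_subset[of A "U \<times> U"] by simp
qed

lemma no_cycle: "\<not> is_cycle (undirected A) p"
  using rooted unfolding rooted_tree_def is_tree_def by meson

lemma asym: "(a, b) \<in> A \<Longrightarrow> (b, a) \<notin> A"
  using rooted unfolding rooted_tree_def by blast

lemma to_root: "a \<in> U \<Longrightarrow> (a, r) \<in> A\<^sup>*"
  using rooted unfolding rooted_tree_def by blast

text \<open>A directed cycle is an undirected one unless it has length 2, where the orientation
  forbids it.\<close>

lemma acyclic: "(u, a) \<in> A \<Longrightarrow> (a, u) \<notin> A\<^sup>*"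
proof
  assume ua: "(u, a) \<in> A" and "(a, u) \<in> A\<^sup>*"
  moreover have "A \<subseteq> {(x, y). {x, y} \<in> undirected A}" by (force simp: undirected_def)
  ultimately obtain p where p: "p \<noteq> []" "hd p = a" "last p = u" "distinct p"
    "successively (\<lambda>x y. (x, y) \<in> A) p"
    by (metis distinct_path)
  have "length p \<noteq> 2"
  proof
    assume "length p = 2"
    then obtain x y where "p = [x, y]" by (auto simp: length_Suc_conv numeral_2_eq_2)
    then show False using p asym[OF ua] by simp
  qed
  moreover have "successively (\<lambda>x y. {x, y} \<in> undirected A) p"
    using p(5) by (rule successively_mono) (force simp: undirected_def)
  moreover have "{u, a} \<in> undirected A" using ua by (force simp: undirected_def)
  ultimately show False using p no_cycle[of p] by (auto simp: is_cycle_def)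
qed

lemma root_no_out: "(r, b) \<notin> A"
  using acyclic[of r b] to_root[of b] arcs_in[of r b] by auto

text \<open>Following the arcs from \<open>a\<close> and from \<open>b\<close> to the root never returns to \<open>u\<close>, as there are no
  directed cycles. So \<open>a\<close> and \<open>b\<close> are joined by a path that avoids \<open>u\<close>, and together with the edge
  between \<open>b\<close> and \<open>u\<close> it is a detour for the edge between \<open>u\<close> and \<open>a\<close>.\<close>

lemma out_unique:
  assumes "(u, a) \<in> A" "(u, b) \<in> A"
  shows "a = b"
proof (rule ccontr)
  assume "a \<noteq> b"
  let ?A' = "{f \<in> A. fst f \<noteq> u}" and ?R = "{(x, y). {x, y} \<in> undirected A - {{a, u}}}"
  have root': "(x, r) \<in> ?A'\<^sup>*" if "(x, r) \<in> A\<^sup>*" "(u, x) \<in> A\<^sup>+" for x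
    using that
  proof (induction rule: converse_rtrancl_induct)
    case (step x y)
    have "x \<noteq> u"
      using acyclic step.prems by (metis converse_tranclE rtrancl.rtrancl_refl trancl_into_rtrancl)
    moreover have "(u, y) \<in> A\<^sup>+" using step by (meson trancl.trancl_into_trancl)
    ultimately show ?case using step by (intro converse_rtrancl_into_rtrancl[of x y]) auto
  qed simp
  have "?A' \<subseteq> ?R"
    using asym assms by (auto simp: undirected_def doubleton_eq_iff)
  then have "(a, r) \<in> ?R\<^sup>*" "(b, r) \<in> ?R\<^sup>*"
    using root'[of a] root'[of b] to_root[of a] to_root[of b] arcs_in[OF assms(1)]
      arcs_in[OF assms(2)] assms rtrancl_mono[of ?A' ?R] by auto
  moreover have "sym ?R" by (auto simp: sym_def insert_commute)
  ultimately have "(a, b) \<in> ?R\<^sup>*" by (meson rtrancl_trans sym_rtrancl symD)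
  moreover have "(b, u) \<in> ?R"
    using assms \<open>a \<noteq> b\<close> by (auto simp: undirected_def doubleton_eq_iff insert_commute intro!: image_eqI[of _ _ "(u, b)"])
  ultimately have au: "(a, u) \<in> ?R\<^sup>*" by (rule rtrancl_into_rtrancl)
  have "{a, u} \<in> undirected A"
    using assms(1) by (auto simp: undirected_def insert_commute intro!: image_eqI[of _ _ "(u, a)"])
  from cycle_of_detour[OF this au] show False using no_cycle by simp
qed

lemma inj_fst: "inj_on fst A"
  by (auto simp: inj_on_def dest: out_unique)

lemma tails: "fst ` A = U - {r}"
proof (intro equalityI subsetI)
  fix u assume "u \<in> fst ` A"
  then obtain b where "(u, b) \<in> A" by auto
  then show "u \<in> U - {r}" using arcs_in[of u b] root_no_out[of b] by auto
next
  fix u assume "u \<in> U - {r}"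
  then have "(u, r) \<in> A\<^sup>*" "u \<noteq> r" using to_root by auto
  then obtain b where "(u, b) \<in> A" by (metis converse_rtranclE)
  then show "u \<in> fst ` A" by force
qed

lemma vertices: "U = insert r (fst ` A)"
  using tails root_in by auto

lemma card_arcs: "card A = card U - 1"
  using card_image[OF inj_fst] tails fin root_in by simp

lemma leaf_above:
  assumes "x \<in> U" "x \<noteq> r"
  obtains y where "is_leaf A r y" "(y, x) \<in> A\<^sup>*"
proof -
  \<comment> \<open>Going backward from x as long as possible ends at a leaf.\<close>
  have "acyclic A" using acyclic by (auto simp: acyclic_def dest!: tranclD)
  then have "wf A" using fin by (simp add: finite_acyclic_wf)
  then obtain y where y: "(y, x) \<in> A\<^sup>*" and "\<And>z. (z, y) \<in> A \<Longrightarrow> (z, x) \<notin> A\<^sup>*"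
    using wfE_min[of A x "{y. (y, x) \<in> A\<^sup>*}"] by auto
  then have no_in: "(z, y) \<notin> A" for z by (meson converse_rtrancl_into_rtrancl)
  have "y \<noteq> r" using y assms root_no_out by (metis converse_rtranclE)
  moreover have "y \<in> U" using y assms arcs_in by (metis converse_rtranclE)
  ultimately have "y \<in> fst ` A" using tails by simp
  then obtain b where b: "(y, b) \<in> A" by auto
  have "{f \<in> A. fst f = y \<or> snd f = y} = {(y, b)}"
  proof (intro equalityI subsetI)
    fix f assume "f \<in> {f \<in> A. fst f = y \<or> snd f = y}"
    then show "f \<in> {(y, b)}" using no_in out_unique[OF b] by (cases f) auto
  qed (use b in simp)
  then have "is_leaf A r y" using \<open>y \<noteq> r\<close> by (simp add: is_leaf_def)
  then show ?thesis using y that by blast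
qed

lemma path_distinct: "successively (\<lambda>x y. (x, y) \<in> A) p \<Longrightarrow> distinct p"
proof -
  assume "successively (\<lambda>x y. (x, y) \<in> A) p"
  then have "successively (\<lambda>x y. (x, y) \<in> A\<^sup>+) p" by (rule successively_mono) auto
  then have "sorted_wrt (\<lambda>x y. (x, y) \<in> A\<^sup>+) p"
    by (subst (asm) successively_conv_sorted_wrt) (auto simp: transp_def)
  moreover have "(x, x) \<notin> A\<^sup>+" for x using acyclic by (auto dest!: tranclD)
  ultimately show "distinct p" by (induction p) auto
qed

text \<open>The condition on the labels concerns paths from leaves only, so the two arcs are extended
  backward to a leaf and forward to the root. The resulting path is injective as there are no
  directed cycles.\<close>

lemma label_less:
  assumes dec: "decreasing_labels A r l" and xp: "(x, p) \<in> A" and pq: "(p, q) \<in> A"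
  shows "the (l (p, q)) < the (l (x, p))"
proof -
  have "x \<in> U" "x \<noteq> r" "q \<in> U" using arcs_in xp pq root_no_out by auto
  obtain y where y: "is_leaf A r y" "(y, x) \<in> A\<^sup>*"
    using leaf_above[OF \<open>x \<in> U\<close> \<open>x \<noteq> r\<close>] by blast
  obtain us where us: "us \<noteq> []" "hd us = y" "last us = x" "successively (\<lambda>x y. (x, y) \<in> A) us"
    using distinct_path[OF y(2)] by blast
  obtain vs where vs: "vs \<noteq> []" "hd vs = q" "last vs = r" "successively (\<lambda>x y. (x, y) \<in> A) vs"
    using distinct_path[OF to_root[OF \<open>q \<in> U\<close>]] by blast
  let ?w = "us @ p # vs"
  have s: "successively (\<lambda>x y. (x, y) \<in> A) ?w"
    using us vs xp pq by (auto simp: successively_append_iff successively_Cons)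
  have "?w \<noteq> []" "hd ?w = y" "last ?w = r" using us vs by auto
  then have sorted: "sorted_wrt (>) (map (\<lambda>f. the (l f)) (zip ?w (tl ?w)))"
    using dec s path_distinct[OF s] y(1) unfolding decreasing_labels_def by metis
  obtain us' where us': "us = us' @ [x]" using us(1,3) by (metis append_butlast_last_id)
  obtain vs' where vs': "vs = q # vs'" using vs(1,2) by (metis list.collapse)
  have "?w = us' @ x # p # vs" "tl ?w = tl us @ p # vs" by (cases us'; simp add: us')+
  moreover have "zip (us' @ x # p # vs) (tl us @ p # vs) = zip us' (tl us) @ zip (x # p # vs) (p # vs)"
    by (rule zip_append) (simp add: us')
  ultimately have "zip ?w (tl ?w) = zip us' (tl us) @ (x, p) # (p, q) # zip vs (tl vs)"
    by (simp only: vs' zip_Cons_Cons list.sel)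
  then show ?thesis using sorted by (simp only: map_append list.map sorted_wrt_append sorted_wrt.simps) simp
qed

text \<open>The list is obtained by sorting the arcs by label. It is growing because the head of an arc is
  the root or has an outgoing arc with a smaller label.\<close>

lemma is_tree_of:
  assumes l: "dom l = A" "ran l = {1..card U - 1}" and dec: "decreasing_labels A r l"
  shows "\<exists>al. growing r al \<and> set al = A \<and> l = numbering al"
proof -
  let ?k = "card U - 1"
  define L where "L f = the (l f)" for f
  have lL: "l f = Some (L f)" if "f \<in> A" for f using that l(1) by (auto simp: L_def dom_def)
  have "L ` A = ran l"
  proof (intro equalityI subsetI)
    fix k assume "k \<in> ran l"
    then obtain f where f: "l f = Some k" by (auto simp: ran_def)
    then have "f \<in> A" using l(1) by (simp add: domI flip: l(1))
    then show "k \<in> L ` A" using f by (force simp: L_def)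
  next
    fix k assume "k \<in> L ` A"
    then show "k \<in> ran l" using lL by (auto intro: ranI)
  qed
  then have img: "L ` A = {1..?k}" using l(2) by simp
  have "inj_on L A" using img card_arcs fin by (intro eq_card_imp_inj_on) auto
  define al where "al = map (\<lambda>i. inv_into A L (Suc i)) [0..<?k]"
  have len: "length al = ?k" by (simp add: al_def)
  have nth: "al ! i \<in> A" "L (al ! i) = Suc i" if "i < ?k" for i
  proof -
    have "Suc i \<in> L ` A" using that img by simp
    then show "al ! i \<in> A" "L (al ! i) = Suc i"
      using that by (simp_all add: al_def inv_into_into f_inv_into_f)
  qed
  have set: "set al = A"
  proof
    show "set al \<subseteq> A"
    proof
      fix f assume "f \<in> set al"
      then obtain i where "i < length al" "f = al ! i" by (metis in_set_conv_nth)
      then show "f \<in> A" using nth(1)[of i] len by simp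
    qed
    show "A \<subseteq> set al"
    proof
      fix f assume f: "f \<in> A"
      then have "L f \<in> {1..?k}" using img by blast
      then have i: "L f - 1 < ?k" "Suc (L f - 1) = L f" by auto
      then have "al ! (L f - 1) = f"
        using nth[of "L f - 1"] f \<open>inj_on L A\<close> by (auto dest: inj_onD)
      then show "f \<in> set al" using i(1) len by (metis nth_mem)
    qed
  qed
  have "distinct al" using set len card_arcs by (simp add: card_distinct)
  then have num: "l = numbering al"
  proof (rule numbering_eqI)
    fix f assume "f \<notin> set al"
    then show "l f = None" using l(1) set by (metis domIff)
  next
    fix i assume "i < length al"
    then show "l (al ! i) = Some (Suc i)" using lL[of "al ! i"] nth[of i] by (simp add: len)
  qed
  have "snd (al ! i) \<in> insert r (fst ` set (take i al))" if i: "i < length al" for i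
  proof -
    obtain x p where xp: "al ! i = (x, p)" by force
    then have "(x, p) \<in> A" using nth[of i] i len by simp
    show ?thesis
    proof (cases "p = r")
      case False
      then have "p \<in> fst ` A" using tails arcs_in[OF \<open>(x, p) \<in> A\<close>] by simp
      then obtain q where q: "(p, q) \<in> A" by auto
      then obtain j where j: "j < length al" "al ! j = (p, q)" using set by (metis in_set_conv_nth)
      have "L (p, q) < L (x, p)" using label_less[OF dec \<open>(x, p) \<in> A\<close> q] by (simp add: L_def)
      then have "j < i" using nth(2)[of i] nth(2)[of j] i j xp len by simp
      then have "(p, q) \<in> set (take i al)" using j i by (force simp: in_set_conv_nth)
      then show ?thesis by (force simp: xp)
    qed (simp add: xp)
  qed
  moreover have "distinct (r # map fst al)"
    using \<open>distinct al\<close> inj_fst set tails by (simp add: distinct_map)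
  ultimately have "growing r al" by (simp add: growing_def)
  then show ?thesis using set num by blast
qed

end

lemma S_is_pioneer_tree:
  assumes "s \<in> S V E n"
  obtains xs where "xs \<noteq> []" "set xs \<subseteq> V" "successively (\<lambda>a b. {a, b} \<in> E) xs"
    "card (set xs) = n" "s = pioneer_tree n xs"
proof -
  obtain U A r l where s: "s = (((U, A), r), l)" and t: "rooted_tree U A r" "U \<subseteq> V" "undirected A \<subseteq> E"
      "card U = n" "dom l = A" "ran l = {1..n - 1}" "decreasing_labels A r l"
    using assms unfolding S_def by blast
  interpret rooted_tree_arcs U A r using t(1) by unfold_locales
  obtain al where al: "growing r al" "set al = A" "l = numbering al"
    using is_tree_of[of l] t(4-7) by blast
  obtain xs where xs: "xs \<noteq> []" "hd xs = r" "successively (\<lambda>a b. {a, b} \<in> E) xs" "pioneers xs = al"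
    using growing_is_pioneers[OF al(1)] t(3) al(2) by metis
  have U: "set xs = U" using set_pioneers[OF xs(1)] xs al vertices by simp
  then have "take (n - 1) al = al" using card_pioneers[OF xs(1)] xs t(4) by simp
  then have "s = pioneer_tree n xs"
    using s vertices al xs by (simp add: pioneer_tree_def tree_of_def)
  moreover have "set xs \<subseteq> V" "card (set xs) = n" using U t by simp_all
  ultimately show ?thesis using that[of xs] xs by simp
qed

lemma finite_S: "finite V \<Longrightarrow> finite (S V E n)"
proof -
  assume V: "finite V"
  have "S V E n \<subseteq> ((Pow V \<times> Pow (V \<times> V)) \<times> V) \<times>
      (\<Union>A\<in>Pow (V \<times> V). {l. dom l = A \<and> ran l \<subseteq> {1..n - 1}})"
  proof
    fix s assume "s \<in> S V E n"
    then obtain U A r l where s: "s = (((U, A), r), l)" and t: "rooted_tree U A r" "U \<subseteq> V"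
        "dom l = A" "ran l = {1..n - 1}"
      unfolding S_def by blast
    interpret rooted_tree_arcs U A r using t(1) by unfold_locales
    have "A \<subseteq> V \<times> V" using t(2) by (intro subrelI) (auto dest: arcs_in)
    then show "s \<in> ((Pow V \<times> Pow (V \<times> V)) \<times> V) \<times>
      (\<Union>A\<in>Pow (V \<times> V). {l. dom l = A \<and> ran l \<subseteq> {1..n - 1}})"
      unfolding s using t root_in by (auto simp del: UN_iff intro!: UN_I[of A])
  qed
  moreover have "finite (\<Union>A\<in>Pow (V \<times> V). {l. dom l = A \<and> ran l \<subseteq> {1..n - 1}})"
  proof (rule finite_UN_I)
    show "finite (Pow (V \<times> V))" using V by simp
    fix A assume "A \<in> Pow (V \<times> V)"
    then have "finite A" using V by (meson PowD finite_SigmaI finite_subset)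
    then show "finite {l. dom l = A \<and> ran l \<subseteq> {1..n - 1}}"
      by (rule finite_set_of_finite_maps) simp
  qed
  moreover have "finite ((Pow V \<times> Pow (V \<times> V)) \<times> V)" using V by simp
  ultimately show ?thesis by (meson finite_SigmaI finite_subset)
qed

section \<open>Invariant measures of finite irreducible chains\<close>

text \<open>The equation at \<open>b\<close> shows that a zero at \<open>b\<close> propagates to every \<open>a\<close> with \<open>P a b > 0\<close>.\<close>

lemma invariant_measure_zero:
  assumes irr: "irreducible_on X P" and fin: "finite X"
    and P0: "\<And>x y. x \<in> X \<Longrightarrow> y \<in> X \<Longrightarrow> P x y \<ge> 0"
    and nu0: "\<And>x. x \<in> X \<Longrightarrow> \<nu> x \<ge> (0 :: real)"
    and inv: "\<And>y. y \<in> X \<Longrightarrow> (\<Sum>x\<in>X. \<nu> x * P x y) = \<nu> y"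
    and z: "z \<in> X" "\<nu> z = 0" and x: "x \<in> X"
  shows "\<nu> x = 0"
proof -
  have "(x, z) \<in> {(a, b). a \<in> X \<and> b \<in> X \<and> P a b > 0}\<^sup>*"
    using irr x z by (simp add: irreducible_on_def)
  then show ?thesis
  proof (induction rule: converse_rtrancl_induct)
    case (step a b)
    then have ab: "a \<in> X" "b \<in> X" "P a b > 0" by auto
    have "\<nu> a * P a b \<le> (\<Sum>x\<in>X. \<nu> x * P x b)"
      using ab fin P0 nu0 by (intro member_le_sum) auto
    also have "\<dots> = 0" using inv ab step.IH by simp
    finally have "\<nu> a \<le> 0" using ab by (simp add: mult_le_0_iff)
    then show ?case using nu0 ab by force
  qed (rule z)
qed

lemma invariant_distribution_pos:
  assumes "irreducible_on X P" "finite X" "transition_matrix X P"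
    and "invariant_distribution X P \<mu>" "x \<in> X"
  shows "\<mu> x > 0"
proof (rule ccontr)
  assume "\<not> \<mu> x > 0"
  then have "\<mu> x = 0" using assms(4,5) by (force simp: invariant_distribution_def)
  have "\<mu> y = 0" if "y \<in> X" for y
    by (rule invariant_measure_zero[where \<nu> = \<mu>, OF assms(1,2) _ _ _ assms(5) \<open>\<mu> x = 0\<close> that])
      (use assms(3,4) in \<open>auto simp: invariant_distribution_def transition_matrix_def\<close>)
  then show False using assms(4) by (simp add: invariant_distribution_def)
qed

text \<open>Subtracting from \<open>\<mu>\<close> the largest multiple of \<open>\<nu>\<close> that lies below it leaves an invariant measure
  with a zero.\<close>

lemma invariant_distribution_unique:
  assumes irr: "irreducible_on X P" and fin: "finite X" and tm: "transition_matrix X P"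
    and mu: "invariant_distribution X P \<mu>" and nu: "invariant_distribution X P \<nu>" and x: "x \<in> X"
  shows "\<mu> x = \<nu> x"
proof -
  have pos: "\<nu> y > 0" if "y \<in> X" for y
    using invariant_distribution_pos[OF irr fin tm nu that] .
  define c where "c = Min ((\<lambda>y. \<mu> y / \<nu> y) ` X)"
  have "c \<in> (\<lambda>y. \<mu> y / \<nu> y) ` X" unfolding c_def using fin x by (intro Min_in) auto
  then obtain z where z: "z \<in> X" "c = \<mu> z / \<nu> z" by blast
  define \<delta> where "\<delta> y = \<mu> y - c * \<nu> y" for y
  have "\<delta> y \<ge> 0" if "y \<in> X" for y
  proof -
    have "c \<le> \<mu> y / \<nu> y" unfolding c_def using fin that by (intro Min_le) auto
    then show ?thesis using pos[OF that] by (simp add: \<delta>_def field_simps)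
  qed
  moreover have "(\<Sum>x\<in>X. \<delta> x * P x y) = \<delta> y" if "y \<in> X" for y
    using mu nu that
    by (simp add: \<delta>_def invariant_distribution_def left_diff_distrib sum_subtractf mult.assoc
        sum_distrib_left[symmetric])
  moreover have "\<delta> z = 0" using z pos[OF z(1)] by (simp add: \<delta>_def)
  ultimately have zero: "\<delta> y = 0" if "y \<in> X" for y
    using invariant_measure_zero[where \<nu> = \<delta>, OF irr fin _ _ _ z(1) _ that] tm
    by (auto simp: transition_matrix_def)
  have "1 - c = (\<Sum>y\<in>X. \<delta> y)"
    using mu nu by (simp add: \<delta>_def invariant_distribution_def sum_subtractf sum_distrib_left[symmetric])
  then have "c = 1" using zero by simp
  then show ?thesis using zero[OF x] by (simp add: \<delta>_def)
qed

section \<open>Ergodicity of the kernel\<close>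

locale positive_chain =
  fixes V :: "'v set" and E :: "'v set set" and M :: "'v \<Rightarrow> 'v \<Rightarrow> real" and \<rho> :: "'v \<Rightarrow> real"
  assumes finV: "finite V" and conn: "connected_graph V E"
    and tmM: "transition_matrix V M" and pos: "positive_on V E M"
    and invM: "invariant_distribution V M \<rho>"
begin

abbreviation walk :: "'v list \<Rightarrow> bool" where
  "walk xs \<equiv> xs \<noteq> [] \<and> set xs \<subseteq> V \<and> successively (\<lambda>a b. {a, b} \<in> E) xs"

lemma M_nonneg: "a \<in> V \<Longrightarrow> b \<in> V \<Longrightarrow> M a b \<ge> 0"
  using tmM by (simp add: transition_matrix_def)

lemma M_pos_iff: "a \<in> V \<Longrightarrow> b \<in> V \<Longrightarrow> M a b > 0 \<longleftrightarrow> {a, b} \<in> E"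
  using pos by (simp add: positive_on_def)

lemma edge_in: "{a, b} \<in> E \<Longrightarrow> a \<in> V \<and> b \<in> V"
  using conn by (fastforce simp: connected_graph_def graph_on_def doubleton_eq_iff)

lemma irreducible_M: "irreducible_on V M"
proof -
  have "{(x, y). {x, y} \<in> E} \<subseteq> {(a, b). a \<in> V \<and> b \<in> V \<and> M a b > 0}"
    using edge_in M_pos_iff by blast
  then show ?thesis
    using conn rtrancl_mono unfolding irreducible_on_def connected_graph_def by blast
qed

lemma rho_pos: "v \<in> V \<Longrightarrow> \<rho> v > 0"
  using invariant_distribution_pos[OF irreducible_M finV tmM invM] .

lemma walk_between:
  assumes "a \<in> V" "b \<in> V"
  obtains p where "walk p" "hd p = a" "last p = b"
proof -
  have "(a, b) \<in> {(x, y). {x, y} \<in> E}\<^sup>*" using conn assms by (simp add: connected_graph_def)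
  then obtain p where p: "p \<noteq> []" "hd p = a" "last p = b" "successively (\<lambda>x y. {x, y} \<in> E) p"
    using distinct_path[of a b "{(x, y). {x, y} \<in> E}"] by auto
  have "set p \<subseteq> V"
    using p(4) p(1) p(2) assms(1)
    by (induction p arbitrary: a rule: induct_list012) (auto dest: edge_in)
  then show ?thesis using that p by blast
qed

lemma walk_append_tl:
  assumes "walk xs" "walk p" "hd p = last xs"
  shows "walk (xs @ tl p)" "last (xs @ tl p) = last p"
proof -
  obtain q where q: "p = last xs # q" using assms(2,3) by (cases p) auto
  show "walk (xs @ tl p)" "last (xs @ tl p) = last p"
    using assms by (cases q; auto simp: q successively_append_iff)+
qed

lemma covering_walk: obtains xs where "walk xs" "set xs = V"
proof -
  have "\<exists>xs. walk xs \<and> F \<subseteq> set xs" if "finite F" "F \<subseteq> V" for F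
    using that
  proof (induction rule: finite_induct)
    case empty
    obtain a where "a \<in> V" using conn by (auto simp: connected_graph_def)
    then show ?case by (intro exI[of _ "[a]"]) simp
  next
    case (insert v F)
    then obtain xs where xs: "walk xs" "F \<subseteq> set xs" by blast
    have "last xs \<in> V" "v \<in> V" using xs insert.prems by (auto dest: last_in_set)
    then obtain p where p: "walk p" "hd p = last xs" "last p = v" by (rule walk_between)
    have "walk (xs @ tl p)" "last (xs @ tl p) = v"
      using walk_append_tl[OF xs(1) p(1,2)] p(3) by simp_all
    then show ?case using xs(2) last_in_set[of "xs @ tl p"] by (intro exI[of _ "xs @ tl p"]) auto
  qed
  from this[OF finV order_refl] show ?thesis using that by blast
qed

lemma walk_tree_in_S: "walk xs \<Longrightarrow> 1 \<le> n \<Longrightarrow> n \<le> card (set xs) \<Longrightarrow> pioneer_tree n xs \<in> S V E n"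
  using pioneer_tree_in_S[of xs V E n] by blast

lemma S_nonempty: "1 \<le> n \<Longrightarrow> n \<le> card V \<Longrightarrow> S V E n \<noteq> {}"
  using covering_walk walk_tree_in_S by (metis empty_iff)

abbreviation rev_step :: "'v \<Rightarrow> 'v \<Rightarrow> real" where
  "rev_step \<equiv> time_reversal \<rho> M"

lemma rev_step_nonneg: "u \<in> V \<Longrightarrow> v \<in> V \<Longrightarrow> rev_step u v \<ge> 0"
  using rho_pos[of u] rho_pos[of v] M_nonneg by (auto simp: time_reversal_def)

lemma rev_step_pos: "{v, u} \<in> E \<Longrightarrow> rev_step u v > 0"
  using rho_pos[of u] rho_pos[of v] edge_in[of v u] M_pos_iff by (auto simp: time_reversal_def)

lemma rev_step_zero: "u \<in> V \<Longrightarrow> v \<in> V \<Longrightarrow> {v, u} \<notin> E \<Longrightarrow> rev_step u v = 0"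
  using M_pos_iff[of v u] M_nonneg[of v u] by (auto simp: time_reversal_def)

lemma rev_step_sum: "u \<in> V \<Longrightarrow> (\<Sum>v\<in>V. rev_step u v) = 1"
  using rho_pos[of u] invM
  by (simp add: time_reversal_def sum_divide_distrib[symmetric] invariant_distribution_def)

lemma K_eq: "K V M \<rho> s t = (\<Sum>v\<in>V. of_bool (move s v = t) * rev_step (root s) v)"
  unfolding K_def using finV by (intro sum.mono_neutral_cong_left) auto

lemma S_root: "s \<in> S V E n \<Longrightarrow> root s \<in> V"
  using S_is_pioneer_tree[of s V E n] by (metis root_pioneer_tree list.set_sel(1) subsetD)

lemma move_in_S:
  assumes "1 \<le> n" "s \<in> S V E n" "{v, root s} \<in> E"
  shows "move s v \<in> S V E n"
proof -
  obtain xs where xs: "walk xs" "card (set xs) = n" "s = pioneer_tree n xs"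
    using S_is_pioneer_tree[OF assms(2)] by metis
  have "successively (\<lambda>a b. {a, b} \<in> E) (v # xs)"
    using xs assms(3) by (cases xs) (auto simp: root_pioneer_tree)
  then have "walk (v # xs)" using xs edge_in[OF assms(3)] by auto
  moreover have "card (set xs) \<le> card (set (v # xs))" by (intro card_mono) auto
  ultimately have "pioneer_tree n (v # xs) \<in> S V E n"
    using walk_tree_in_S[of "v # xs" n] xs assms(1) by simp
  then show ?thesis using move_pioneer_tree[of xs n v] xs assms(1) by simp
qed

lemma K_stochastic: "1 \<le> n \<Longrightarrow> transition_matrix (S V E n) (K V M \<rho>)"
  unfolding transition_matrix_def
proof (intro ballI conjI)
  fix s t assume "s \<in> S V E n"
  then show "K V M \<rho> s t \<ge> 0"
    unfolding K_eq by (intro sum_nonneg mult_nonneg_nonneg rev_step_nonneg S_root) auto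
next
  fix s assume n: "1 \<le> n" and s: "s \<in> S V E n"
  have "(\<Sum>t\<in>S V E n. K V M \<rho> s t)
      = (\<Sum>v\<in>V. \<Sum>t\<in>S V E n. of_bool (move s v = t) * rev_step (root s) v)"
    unfolding K_eq by (rule sum.swap)
  also have "\<dots> = (\<Sum>v\<in>V. rev_step (root s) v)"
  proof (rule sum.cong)
    fix v assume v: "v \<in> V"
    have "(\<Sum>t\<in>S V E n. of_bool (move s v = t) * rev_step (root s) v)
        = of_bool (move s v \<in> S V E n) * rev_step (root s) v"
      using finite_S[OF finV, of E n]
      by (simp add: of_bool_def if_distrib[of "\<lambda>c. c * _"] sum.delta' cong: if_cong)
    also have "\<dots> = rev_step (root s) v"
      using move_in_S[OF n s, of v] rev_step_zero[OF S_root[OF s] v] by (cases "{v, root s} \<in> E") auto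
    finally show "(\<Sum>t\<in>S V E n. of_bool (move s v = t) * rev_step (root s) v) = rev_step (root s) v" .
  qed simp
  finally show "(\<Sum>t\<in>S V E n. K V M \<rho> s t) = 1" using rev_step_sum[OF S_root[OF s]] by simp
qed

text \<open>Each prepended vertex is a move of positive probability.\<close>

lemma K_prepend:
  assumes "1 \<le> n" "n \<le> card (set xs)" "xs \<noteq> []" "walk (zs @ xs)"
  shows "(pioneer_tree n xs, pioneer_tree n (zs @ xs))
    \<in> {(s, t). s \<in> S V E n \<and> t \<in> S V E n \<and> K V M \<rho> s t > 0}\<^sup>*"
  using assms(4)
proof (induction zs)
  case (Cons v zs)
  let ?s = "pioneer_tree n (zs @ xs)" and ?t = "pioneer_tree n (v # zs @ xs)"
  have w: "walk (zs @ xs)" and e: "{v, hd (zs @ xs)} \<in> E"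
    using Cons.prems assms(3) by (auto simp: successively_Cons)
  have c: "n \<le> card (set (ys @ xs))" for ys
  proof -
    have "card (set xs) \<le> card (set (ys @ xs))" by (intro card_mono) auto
    then show ?thesis using assms(2) by simp
  qed
  have S: "?s \<in> S V E n" "?t \<in> S V E n"
    using walk_tree_in_S[OF w assms(1) c] walk_tree_in_S[OF Cons.prems assms(1) c] by simp_all
  have mv: "move ?s v = ?t" using move_pioneer_tree[OF _ assms(1) c] w by simp
  have "0 < rev_step (root ?s) v" using rev_step_pos[OF e] by (simp add: root_pioneer_tree)
  also have "rev_step (root ?s) v = of_bool (move ?s v = ?t) * rev_step (root ?s) v" using mv by simp
  also have "\<dots> \<le> K V M \<rho> ?s ?t"
    unfolding K_eq using finV edge_in[OF e] S_root[OF S(1)]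
    by (intro member_le_sum[of v V "\<lambda>v. of_bool (move ?s v = ?t) * rev_step (root ?s) v"])
      (auto intro: rev_step_nonneg)
  finally show ?case using Cons.IH[OF w] S by (auto intro: rtrancl_into_rtrancl)
qed simp

text \<open>Let \<open>s\<close> and \<open>t\<close> be the trees of \<open>xs\<close> and \<open>ys\<close>. A walk that extends \<open>ys\<close> and then ends with
  \<open>xs\<close> still has the tree \<open>t\<close>, because \<open>ys\<close> discovers \<open>n\<close> vertices by itself.\<close>

lemma K_irreducible:
  assumes n: "1 \<le> n"
  shows "irreducible_on (S V E n) (K V M \<rho>)"
  unfolding irreducible_on_def
proof (intro ballI)
  fix s t assume "s \<in> S V E n" "t \<in> S V E n"
  then obtain xs ys where xs: "walk xs" "card (set xs) = n" "s = pioneer_tree n xs"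
    and ys: "walk ys" "card (set ys) = n" "t = pioneer_tree n ys"
    by (metis S_is_pioneer_tree)
  have "last ys \<in> V" "hd xs \<in> V" using xs ys by (auto dest: last_in_set hd_in_set)
  then obtain p where p: "walk p" "hd p = last ys" "last p = hd xs" by (rule walk_between)
  have w1: "walk (ys @ tl p)" and l1: "last (ys @ tl p) = hd xs"
    using walk_append_tl[OF ys(1) p(1,2)] p(3) by simp_all
  \<comment> \<open>The last vertex of this walk is the first one of xs and must not be repeated.\<close>
  define zs where "zs = butlast (ys @ tl p)"
  have zs: "zs @ xs = ys @ tl p @ tl xs"
  proof -
    have "zs @ [hd xs] = ys @ tl p" unfolding zs_def using l1 w1 append_butlast_last_id by metis
    moreover have "xs = [hd xs] @ tl xs" using xs by simp
    ultimately show ?thesis by (metis append.assoc)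
  qed
  have "walk (zs @ xs)"
    using walk_append_tl(1)[OF w1 xs(1)] l1 unfolding zs by simp
  then show "(s, t) \<in> {(s, t). s \<in> S V E n \<and> t \<in> S V E n \<and> K V M \<rho> s t > 0}\<^sup>*"
    using K_prepend[OF n, of xs zs] xs ys pioneer_tree_append[of ys n "tl p @ tl xs"] zs by simp
qed

lemma K_ergodic: "1 \<le> n \<Longrightarrow> n \<le> card V \<Longrightarrow> ergodic_on (S V E n) (K V M \<rho>)"
  using finite_S[OF finV] S_nonempty K_stochastic K_irreducible by (simp add: ergodic_on_def)

end

section \<open>Tree laws at a finite horizon\<close>

fun path_prob :: "('v \<Rightarrow> 'v \<Rightarrow> real) \<Rightarrow> 'v list \<Rightarrow> real" where
  "path_prob M (a # b # xs) = M a b * path_prob M (b # xs)"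
| "path_prob M _ = 1"

lemma path_prob_snoc: "xs \<noteq> [] \<Longrightarrow> path_prob M (xs @ [a]) = path_prob M xs * M (last xs) a"
  by (induction xs rule: induct_list012) auto

context positive_chain
begin

definition paths :: "nat \<Rightarrow> 'v list set" where
  "paths N = {xs. set xs \<subseteq> V \<and> length xs = Suc N}"

text \<open>The probability of a trajectory of the stationary chain.\<close>

definition weight :: "'v list \<Rightarrow> real" where
  "weight xs = \<rho> (hd xs) * path_prob M xs"

lemma finite_paths [simp]: "finite (paths N)"
  unfolding paths_def using finV by (rule finite_lists_length_eq)

lemma pathsD: "xs \<in> paths N \<Longrightarrow> xs \<noteq> [] \<and> set xs \<subseteq> V \<and> hd xs \<in> V"
  by (cases xs) (auto simp: paths_def)

lemma sum_paths_0: "(\<Sum>xs\<in>paths 0. g xs) = (\<Sum>v\<in>V. g [v])"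
proof -
  have "paths 0 = (\<lambda>v. [v]) ` V" by (auto simp: paths_def length_Suc_conv)
  then show ?thesis by (simp add: sum.reindex inj_on_def)
qed

lemma sum_paths_Suc: "(\<Sum>xs\<in>paths (Suc N). g xs) = (\<Sum>xs\<in>paths N. \<Sum>v\<in>V. g (v # xs))"
proof -
  have "paths (Suc N) = (\<lambda>(xs, v). v # xs) ` (paths N \<times> V)"
    by (auto simp: paths_def length_Suc_conv image_iff)
  moreover have "inj_on (\<lambda>(xs, v). v # xs) (paths N \<times> V)" by (auto simp: inj_on_def)
  ultimately show ?thesis
    by (simp add: sum.reindex sum.cartesian_product case_prod_unfold)
qed

lemma path_prob_nonneg: "set xs \<subseteq> V \<Longrightarrow> path_prob M xs \<ge> 0"
  by (induction xs rule: induct_list012) (auto intro!: mult_nonneg_nonneg M_nonneg)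

lemma path_prob_zero:
  "set xs \<subseteq> V \<Longrightarrow> \<not> successively (\<lambda>a b. {a, b} \<in> E) xs \<Longrightarrow> path_prob M xs = 0"
proof (induction xs rule: induct_list012)
  case (3 a b xs)
  then show ?case using M_pos_iff[of a b] M_nonneg[of a b] by (cases "{a, b} \<in> E") auto
qed auto

lemma weight_nonneg: "xs \<in> paths N \<Longrightarrow> weight xs \<ge> 0"
  using pathsD[of xs N] rho_pos[of "hd xs"] path_prob_nonneg[of xs] by (simp add: weight_def)

lemma weight_Cons:
  "xs \<in> paths N \<Longrightarrow> v \<in> V \<Longrightarrow> weight (v # xs) = weight xs * time_reversal \<rho> M (hd xs) v"
  using pathsD[of xs N] rho_pos[of "hd xs"]
  by (cases xs) (auto simp: weight_def time_reversal_def)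

lemma sum_weight_Cons: "xs \<in> paths N \<Longrightarrow> (\<Sum>v\<in>V. weight (v # xs)) = weight xs"
  using pathsD[of xs N] rev_step_sum[of "hd xs"]
  by (simp add: weight_Cons sum_distrib_left[symmetric])

lemma sum_weight: "(\<Sum>xs\<in>paths N. weight xs) = 1"
proof (induction N)
  case 0
  then show ?case using invM by (simp add: sum_paths_0 weight_def invariant_distribution_def)
next
  case (Suc N)
  then show ?case by (simp add: sum_paths_Suc sum_weight_Cons)
qed

text \<open>The probability that the first \<open>N + 1\<close> positions do not suffice to determine the tree.\<close>

definition short_mass :: "nat \<Rightarrow> nat \<Rightarrow> real" where
  "short_mass n N = (\<Sum>xs\<in>paths N. of_bool (card (set xs) < n) * weight xs)"

definition tree_mass :: "nat \<Rightarrow> nat \<Rightarrow> 'v ltree \<Rightarrow> real" where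
  "tree_mass n N t =
     (\<Sum>xs\<in>paths N. of_bool (n \<le> card (set xs) \<and> pioneer_tree n xs = t) * weight xs)"

lemma tree_in_S:
  assumes "1 \<le> n" "xs \<in> paths N" "n \<le> card (set xs)" "weight xs \<noteq> 0"
  shows "pioneer_tree n xs \<in> S V E n"
proof -
  have "walk xs" using path_prob_zero[of xs] pathsD[OF assms(2)] assms(4) by (auto simp: weight_def)
  then show ?thesis using walk_tree_in_S assms by blast
qed

lemma sum_tree_mass:
  assumes n: "1 \<le> n"
  shows "(\<Sum>s\<in>S V E n. tree_mass n N s * f s)
    = (\<Sum>xs\<in>paths N. of_bool (n \<le> card (set xs)) * (weight xs * f (pioneer_tree n xs)))"
proof -
  have "(\<Sum>s\<in>S V E n. tree_mass n N s * f s) = (\<Sum>s\<in>S V E n. \<Sum>xs\<in>paths N.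
      of_bool (n \<le> card (set xs)) * (weight xs * (of_bool (pioneer_tree n xs = s) * f s)))"
    unfolding tree_mass_def sum_distrib_right
    by (intro sum.cong refl) (auto simp: of_bool_def)
  also have "\<dots> = (\<Sum>xs\<in>paths N. \<Sum>s\<in>S V E n.
      of_bool (n \<le> card (set xs)) * (weight xs * (of_bool (pioneer_tree n xs = s) * f s)))"
    by (rule sum.swap)
  also have "\<dots> = (\<Sum>xs\<in>paths N. of_bool (n \<le> card (set xs)) * (weight xs * f (pioneer_tree n xs)))"
  proof (rule sum.cong)
    fix xs assume xs: "xs \<in> paths N"
    have "(\<Sum>s\<in>S V E n. of_bool (pioneer_tree n xs = s) * f s)
        = of_bool (pioneer_tree n xs \<in> S V E n) * f (pioneer_tree n xs)"
      using finite_S[OF finV, of E n]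
      by (simp add: of_bool_def if_distrib[of "\<lambda>c. c * _"] sum.delta' cong: if_cong)
    then show "(\<Sum>s\<in>S V E n.
        of_bool (n \<le> card (set xs)) * (weight xs * (of_bool (pioneer_tree n xs = s) * f s)))
      = of_bool (n \<le> card (set xs)) * (weight xs * f (pioneer_tree n xs))"
      using tree_in_S[OF n xs] by (auto simp: sum_distrib_left[symmetric] of_bool_def)
  qed simp
  finally show ?thesis .
qed

lemma tree_mass_total: "1 \<le> n \<Longrightarrow> (\<Sum>s\<in>S V E n. tree_mass n N s) = 1 - short_mass n N"
proof -
  assume n: "1 \<le> n"
  have "(\<Sum>s\<in>S V E n. tree_mass n N s) + short_mass n N
      = (\<Sum>xs\<in>paths N. of_bool (n \<le> card (set xs)) * weight xs + of_bool (card (set xs) < n) * weight xs)"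
    using sum_tree_mass[OF n, of N "\<lambda>_. 1"] by (simp add: short_mass_def sum.distrib)
  also have "\<dots> = (\<Sum>xs\<in>paths N. weight xs)"
    by (intro sum.cong) (auto simp: of_bool_def)
  finally show ?thesis by (simp add: sum_weight)
qed

text \<open>A trajectory of length \<open>N + 2\<close> is one of length \<open>N + 1\<close> with a prepended vertex. If the shorter
  one already discovers \<open>n\<close> vertices, the contribution is a step of the kernel; the others have
  total weight at most \<open>short_mass n N\<close>.\<close>

lemma tree_mass_step:
  assumes n: "1 \<le> n"
  shows "\<bar>tree_mass n (Suc N) t - (\<Sum>s\<in>S V E n. tree_mass n N s * K V M \<rho> s t)\<bar> \<le> short_mass n N"
proof -
  let ?hit = "\<lambda>xs v. n \<le> card (set (v # xs)) \<and> pioneer_tree n (v # xs) = t"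
  let ?g = "\<lambda>xs v. of_bool (card (set xs) < n) * (of_bool (?hit xs v) * weight (v # xs))"
  have "(\<Sum>s\<in>S V E n. tree_mass n N s * K V M \<rho> s t)
      = (\<Sum>xs\<in>paths N. of_bool (n \<le> card (set xs)) * (weight xs * K V M \<rho> (pioneer_tree n xs) t))"
    by (rule sum_tree_mass[OF n])
  also have "\<dots> = (\<Sum>xs\<in>paths N. \<Sum>v\<in>V.
      of_bool (n \<le> card (set xs)) * (of_bool (?hit xs v) * weight (v # xs)))"
  proof (rule sum.cong)
    fix xs assume xs: "xs \<in> paths N"
    show "of_bool (n \<le> card (set xs)) * (weight xs * K V M \<rho> (pioneer_tree n xs) t)
      = (\<Sum>v\<in>V. of_bool (n \<le> card (set xs)) * (of_bool (?hit xs v) * weight (v # xs)))"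
    proof (cases "n \<le> card (set xs)")
      case True
      have "card (set xs) \<le> card (set (v # xs))" for v by (intro card_mono) auto
      then have more: "n \<le> card (set (v # xs))" for v using True le_trans by blast
      show ?thesis
        using True more pathsD[OF xs] weight_Cons[OF xs] move_pioneer_tree[OF _ n True]
        by (simp add: K_eq root_pioneer_tree sum_distrib_left mult.left_commute del: set_simps)
    qed simp
  qed simp
  finally have 1: "(\<Sum>s\<in>S V E n. tree_mass n N s * K V M \<rho> s t) = (\<Sum>xs\<in>paths N. \<Sum>v\<in>V.
      of_bool (n \<le> card (set xs)) * (of_bool (?hit xs v) * weight (v # xs)))" .
  have "tree_mass n (Suc N) t = (\<Sum>xs\<in>paths N. \<Sum>v\<in>V.
      of_bool (n \<le> card (set xs)) * (of_bool (?hit xs v) * weight (v # xs)) + ?g xs v)"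
    unfolding tree_mass_def sum_paths_Suc by (intro sum.cong refl) (simp add: of_bool_def)
  then have 2: "tree_mass n (Suc N) t - (\<Sum>s\<in>S V E n. tree_mass n N s * K V M \<rho> s t)
      = (\<Sum>xs\<in>paths N. \<Sum>v\<in>V. ?g xs v)"
    unfolding 1 by (simp add: sum.distrib)
  have w: "0 \<le> weight (v # xs)" if "xs \<in> paths N" "v \<in> V" for v xs
    using that by (intro weight_nonneg[of _ "Suc N"]) (auto simp: paths_def)
  have "(\<Sum>xs\<in>paths N. \<Sum>v\<in>V. ?g xs v) \<ge> 0"
    using w by (intro sum_nonneg mult_nonneg_nonneg) auto
  moreover have "(\<Sum>xs\<in>paths N. \<Sum>v\<in>V. ?g xs v)
      \<le> (\<Sum>xs\<in>paths N. \<Sum>v\<in>V. of_bool (card (set xs) < n) * weight (v # xs))"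
    using w by (intro sum_mono) (auto simp: of_bool_def)
  moreover have "\<dots> = short_mass n N"
    unfolding short_mass_def by (intro sum.cong) (auto simp: sum_weight_Cons sum_distrib_left[symmetric])
  ultimately show ?thesis using 2 by simp
qed

text \<open>The probability that the chain started at \<open>u\<close> does not visit \<open>v\<close> up to time \<open>N\<close>.\<close>

fun avoid :: "'v \<Rightarrow> nat \<Rightarrow> 'v \<Rightarrow> real" where
  "avoid v 0 u = of_bool (u \<noteq> v)"
| "avoid v (Suc N) u = of_bool (u \<noteq> v) * (\<Sum>w\<in>V. M u w * avoid v N w)"

lemma avoid_nonneg: "u \<in> V \<Longrightarrow> avoid v N u \<ge> 0"
  by (induction N arbitrary: u) (auto intro!: sum_nonneg mult_nonneg_nonneg M_nonneg)

lemma avoid_le_1: "u \<in> V \<Longrightarrow> avoid v N u \<le> 1"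
proof (induction N arbitrary: u)
  case (Suc N)
  have "(\<Sum>w\<in>V. M u w * avoid v N w) \<le> (\<Sum>w\<in>V. M u w * 1)"
    using Suc by (intro sum_mono mult_left_mono M_nonneg) auto
  also have "\<dots> = 1" using tmM Suc.prems by (simp add: transition_matrix_def)
  finally show ?case by simp
qed simp

lemma avoid_decreasing: "u \<in> V \<Longrightarrow> avoid v (Suc N) u \<le> avoid v N u"
proof (induction N arbitrary: u)
  case 0
  then show ?case using avoid_le_1[of u v "Suc 0"] by (cases "u = v") auto
next
  case (Suc N)
  have "(\<Sum>w\<in>V. M u w * avoid v (Suc N) w) \<le> (\<Sum>w\<in>V. M u w * avoid v N w)"
    using Suc by (intro sum_mono mult_left_mono M_nonneg) auto
  then show ?case by (simp only: avoid.simps(2)[of v "Suc N"] avoid.simps(2)[of v N]) (simp add: mult_left_mono)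
qed

text \<open>The limit \<open>a\<close> vanishes at \<open>v\<close> and is harmonic elsewhere. If its maximum were positive, it would
  spread from a vertex where it is attained to all neighbours, and finally to \<open>v\<close>.\<close>

lemma avoid_tendsto_0:
  assumes v: "v \<in> V" and u: "u \<in> V"
  shows "(\<lambda>N. avoid v N u) \<longlonglongrightarrow> 0"
proof -
  have "convergent (\<lambda>N. avoid v N x)" if "x \<in> V" for x
  proof -
    have "decseq (\<lambda>N. avoid v N x)" using avoid_decreasing that by (intro decseq_SucI) blast
    then show ?thesis
      using decseq_convergent[of "\<lambda>N. avoid v N x" 0] avoid_nonneg[OF that] by (metis convergentI)
  qed
  then have lim: "(\<lambda>N. avoid v N x) \<longlonglongrightarrow> lim (\<lambda>N. avoid v N x)" if "x \<in> V" for x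
    using that by (simp add: convergent_LIMSEQ_iff)
  define a where "a x = lim (\<lambda>N. avoid v N x)" for x
  have lim: "(\<lambda>N. avoid v N x) \<longlonglongrightarrow> a x" if "x \<in> V" for x
    using lim[OF that] by (simp add: a_def)
  have a0: "a x \<ge> 0" if "x \<in> V" for x
    using lim[OF that] avoid_nonneg[OF that] by (intro LIMSEQ_le_const) auto
  have rec: "a x = of_bool (x \<noteq> v) * (\<Sum>w\<in>V. M x w * a w)" if "x \<in> V" for x
  proof (rule LIMSEQ_unique)
    show "(\<lambda>N. avoid v (Suc N) x) \<longlonglongrightarrow> a x" using lim[OF that] by (rule LIMSEQ_Suc)
    show "(\<lambda>N. avoid v (Suc N) x) \<longlonglongrightarrow> of_bool (x \<noteq> v) * (\<Sum>w\<in>V. M x w * a w)"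
      unfolding avoid.simps by (intro tendsto_intros lim)
  qed
  define m where "m = Max (a ` V)"
  have "m \<in> a ` V" unfolding m_def using finV u by (intro Max_in) auto
  then obtain z where z: "z \<in> V" "a z = m" by auto
  have le: "a x \<le> m" if "x \<in> V" for x unfolding m_def using finV that by (intro Max_ge) auto
  have "m = 0"
  proof (rule ccontr)
    assume "m \<noteq> 0"
    then have m: "m > 0" using a0 z by force
    have "(z, v) \<in> {(x, y). x \<in> V \<and> y \<in> V \<and> M x y > 0}\<^sup>*"
      using irreducible_M z v by (simp add: irreducible_on_def)
    then have "a v = m"
    proof (induction rule: rtrancl_induct)
      case (step x y)
      then have xy: "x \<in> V" "y \<in> V" "M x y > 0" and ax: "a x = m" by auto
      have "x \<noteq> v" using rec[OF xy(1)] ax m by auto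
      then have "m = (\<Sum>w\<in>V. M x w * a w)" using rec[OF xy(1)] ax by simp
      moreover have "m = (\<Sum>w\<in>V. M x w * m)"
        using tmM xy(1) by (simp add: transition_matrix_def sum_distrib_right[symmetric])
      ultimately have "(\<Sum>w\<in>V. M x w * (m - a w)) = 0"
        by (simp add: right_diff_distrib sum_subtractf)
      then have "M x y * (m - a y) = 0"
        using sum_nonneg_0[OF finV _ _ xy(2), of "\<lambda>w. M x w * (m - a w)"] le M_nonneg[OF xy(1)] by simp
      then show ?case using xy(3) by simp
    qed (rule z)
    then show False using rec[OF v] m by simp
  qed
  then have "a u = 0" using le[OF u] a0[OF u] by simp
  then show ?thesis using lim[OF u] by simp
qed

lemma sum_avoiding_paths:
  "(\<Sum>xs\<in>paths N. of_bool (v \<notin> set xs) * (f (hd xs) * path_prob M xs)) = (\<Sum>u\<in>V. f u * avoid v N u)"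
proof (induction N arbitrary: f)
  case 0
  show ?case by (auto simp: sum_paths_0 of_bool_def intro!: sum.cong)
next
  case (Suc N)
  let ?f = "\<lambda>w. \<Sum>u\<in>V. f u * of_bool (u \<noteq> v) * M u w"
  have "(\<Sum>xs\<in>paths (Suc N). of_bool (v \<notin> set xs) * (f (hd xs) * path_prob M xs))
      = (\<Sum>xs\<in>paths N. of_bool (v \<notin> set xs) * (?f (hd xs) * path_prob M xs))"
    unfolding sum_paths_Suc
  proof (rule sum.cong)
    fix xs assume "xs \<in> paths N"
    then obtain y ys where xs: "xs = y # ys" by (cases xs) (auto simp: paths_def)
    show "(\<Sum>u\<in>V. of_bool (v \<notin> set (u # xs)) * (f (hd (u # xs)) * path_prob M (u # xs)))
        = of_bool (v \<notin> set xs) * (?f (hd xs) * path_prob M xs)"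
      unfolding sum_distrib_left sum_distrib_right
      by (intro sum.cong) (auto simp: xs of_bool_def)
  qed simp
  also have "\<dots> = (\<Sum>w\<in>V. ?f w * avoid v N w)" by (rule Suc.IH)
  also have "\<dots> = (\<Sum>u\<in>V. \<Sum>w\<in>V. f u * of_bool (u \<noteq> v) * M u w * avoid v N w)"
    unfolding sum_distrib_right by (rule sum.swap)
  also have "\<dots> = (\<Sum>u\<in>V. f u * avoid v (Suc N) u)"
    by (simp add: sum_distrib_left mult.assoc)
  finally show ?case .
qed

lemma short_mass_nonneg: "short_mass n N \<ge> 0"
  unfolding short_mass_def by (intro sum_nonneg mult_nonneg_nonneg weight_nonneg) auto

lemma short_mass_tendsto_0:
  assumes "n \<le> card V"
  shows "short_mass n \<longlonglongrightarrow> 0"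
proof -
  let ?b = "\<lambda>N. \<Sum>v\<in>V. \<Sum>u\<in>V. \<rho> u * avoid v N u"
  have "?b \<longlonglongrightarrow> (\<Sum>v\<in>V. \<Sum>u\<in>V. \<rho> u * 0)"
    by (intro tendsto_intros avoid_tendsto_0)
  then have b: "?b \<longlonglongrightarrow> 0" by simp
  have "short_mass n N \<le> ?b N" for N
  proof -
    have "short_mass n N \<le> (\<Sum>xs\<in>paths N. \<Sum>v\<in>V. of_bool (v \<notin> set xs) * weight xs)"
      unfolding short_mass_def
    proof (rule sum_mono)
      fix xs assume xs: "xs \<in> paths N"
      show "of_bool (card (set xs) < n) * weight xs \<le> (\<Sum>v\<in>V. of_bool (v \<notin> set xs) * weight xs)"
      proof (cases "card (set xs) < n")
        case True
        then have "\<not> V \<subseteq> set xs" using assms card_mono[of "set xs" V] by auto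
        then obtain v where v: "v \<in> V" "v \<notin> set xs" by blast
        have "of_bool (v \<notin> set xs) * weight xs \<le> (\<Sum>v\<in>V. of_bool (v \<notin> set xs) * weight xs)"
          using finV v weight_nonneg[OF xs]
          by (intro member_le_sum[of v V "\<lambda>v. of_bool (v \<notin> set xs) * weight xs"]) auto
        then show ?thesis using True v by simp
      qed (use weight_nonneg[OF xs] in \<open>auto intro!: sum_nonneg\<close>)
    qed
    also have "\<dots> = ?b N"
      unfolding weight_def sum_avoiding_paths[symmetric] by (rule sum.swap)
    finally show ?thesis .
  qed
  then show ?thesis
    using short_mass_nonneg by (intro tendsto_sandwich[OF _ _ tendsto_const b]) simp_all
qed

end

section \<open>The law of the pioneer tree\<close>

text \<open>This also covers trajectories that visit too few vertices, for which some hitting times take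
  the default value 0: stopping the trajectory does not make any of them finite. The event that
  the pioneer tree is a given one thereby becomes a limit of events that depend on finitely many
  steps, hence measurable without completing the probability space.\<close>

lemma prt_stopped: "\<exists>N0. \<forall>N\<ge>N0. prt n (\<lambda>i. w (min i N)) = prt n w"
proof (intro exI allI impI)
  fix N assume N: "Max (hitting w ` {0..n}) \<le> N"
  let ?w = "\<lambda>i. w (min i N)"
  have le: "hitting w k \<le> N" if "k \<le> n" for k
    using N Max_ge[of "hitting w ` {0..n}" "hitting w k"] that by force
  have img: "?w ` {0..j} = w ` {0..min j N}" for j
  proof -
    have "(\<lambda>i. min i N) ` {0..j} = {0..min j N}"
    proof (intro equalityI subsetI)
      fix i assume "i \<in> {0..min j N}"
      then show "i \<in> (\<lambda>i. min i N) ` {0..j}" by (intro image_eqI[of _ _ i]) (simp_all add: min_absorb1)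
    qed auto
    then show ?thesis by (metis image_image)
  qed
  have hit: "hitting ?w k = hitting w k" if k: "k \<le> n" for k
  proof (cases "\<exists>j. card (w ` {0..j}) = k")
    case True
    define h where "h = (LEAST j. card (w ` {0..j}) = k)"
    have hk: "card (w ` {0..h}) = k" unfolding h_def using True by (rule LeastI_ex)
    have hw: "hitting w k = h" unfolding hitting_def Inf_nat_def h_def using True by auto
    then have hN: "h \<le> N" using le[OF k] by simp
    have "(LEAST j. card (?w ` {0..j}) = k) = h"
    proof (rule Least_equality)
      show "card (?w ` {0..h}) = k" unfolding img using hk hN by (simp add: min_absorb1)
      fix j assume "card (?w ` {0..j}) = k"
      then have "h \<le> min j N" unfolding img h_def by (rule Least_le)
      then show "h \<le> j" by simp
    qed
    moreover have "\<exists>j. card (?w ` {0..j}) = k" unfolding img using hk hN by (metis min_absorb1)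
    ultimately show ?thesis unfolding hw by (auto simp: hitting_def Inf_nat_def)
  next
    case False
    then have "{j. card (?w ` {0..j}) = k} = {}" "{j. card (w ` {0..j}) = k} = {}" unfolding img by auto
    then show ?thesis unfolding hitting_def by (simp only:)
  qed
  define arc where "arc w = (\<lambda>k. (w (hitting w k), w (hitting w k - 1)))" for w :: "nat \<Rightarrow> 'a"
  have prt: "prt n w = (((w ` {0..hitting w n}, arc w ` {2..n}), w 0),
      map_of (map (\<lambda>k. (arc w k, k - 1)) [2..<n + 1]))" for w :: "nat \<Rightarrow> 'a"
    unfolding prt_def Let_def arc_def ..
  have arc: "arc ?w k = arc w k" if "k \<le> n" for k
    using hit[OF that] le[OF that] by (simp add: arc_def min_absorb1)
  have "arc ?w ` {2..n} = arc w ` {2..n}" by (intro image_cong) (simp_all add: arc)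
  moreover have "map (\<lambda>k. (arc ?w k, k - 1)) [2..<n + 1] = map (\<lambda>k. (arc w k, k - 1)) [2..<n + 1]"
    by (intro map_cong) (simp_all add: arc del: upt_Suc)
  moreover have "?w ` {0..hitting ?w n} = w ` {0..hitting w n}"
    unfolding img hit[OF order_refl] using le[of n] by (simp add: min_absorb1)
  moreover have "?w 0 = w 0" by simp
  ultimately show "prt n ?w = prt n w"
    unfolding prt by (simp only:)
qed

locale positive_chain_process = positive_chain V E M \<rho> + prob_space \<Omega>
  for V :: "'v set" and E M \<rho> and \<Omega> :: "'w measure" +
  fixes W :: "nat \<Rightarrow> 'w \<Rightarrow> 'v"
  assumes chain: "markov_chain \<Omega> V M W"
    and start: "\<And>v. v \<in> V \<Longrightarrow> prob {\<omega> \<in> space \<Omega>. W 0 \<omega> = v} = \<rho> v"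
begin

definition prefix :: "nat \<Rightarrow> 'w \<Rightarrow> 'v list" where
  "prefix N \<omega> = map (\<lambda>i. W i \<omega>) [0..<Suc N]"

lemma W_in: "\<omega> \<in> space \<Omega> \<Longrightarrow> W k \<omega> \<in> V"
  using chain measurable_space[of "W k" \<Omega> "count_space V" \<omega>] by (simp add: markov_chain_def)

lemma W_event [measurable]: "{\<omega> \<in> space \<Omega>. W k \<omega> = v} \<in> events"
proof (cases "v \<in> V")
  case True
  have "W k -` {v} \<inter> space \<Omega> \<in> events"
    using chain True by (intro measurable_sets[of "W k" \<Omega> "count_space V"]) (auto simp: markov_chain_def)
  then show ?thesis by (simp add: vimage_def Int_def conj_commute)
next
  case False
  then have empty: "{\<omega> \<in> space \<Omega>. W k \<omega> = v} = {}" using W_in by auto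
  show ?thesis unfolding empty by simp
qed

lemma prefix_in: "\<omega> \<in> space \<Omega> \<Longrightarrow> prefix N \<omega> \<in> paths N"
  using W_in by (auto simp: prefix_def paths_def)

lemma prefix_eq_iff: "prefix N \<omega> = map w [0..<Suc N] \<longleftrightarrow> (\<forall>i\<le>N. W i \<omega> = w i)"
  by (auto simp: prefix_def less_Suc_eq_le simp del: upt_Suc)

lemma initial_event: "{\<omega> \<in> space \<Omega>. \<forall>i\<le>N. W i \<omega> = w i} \<in> events"
proof -
  have "{\<omega> \<in> space \<Omega>. \<forall>i\<in>{..N}. W i \<omega> = w i} \<in> events"
    by (intro sets.sets_Collect_finite_All W_event) simp
  then show ?thesis by simp
qed

lemma prob_initial:
  assumes "\<And>i. i \<le> N \<Longrightarrow> w i \<in> V"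
  shows "prob {\<omega> \<in> space \<Omega>. \<forall>i\<le>N. W i \<omega> = w i} = weight (map w [0..<Suc N])"
  using assms
proof (induction N)
  case 0
  then show ?case using start by (simp add: weight_def)
next
  case (Suc N)
  let ?A = "{\<omega> \<in> space \<Omega>. \<forall>i\<le>N. W i \<omega> = w i}"
  let ?B = "{\<omega> \<in> space \<Omega>. \<forall>i\<le>Suc N. W i \<omega> = w i}"
  let ?xs = "map w [0..<Suc N]"
  have IH: "prob ?A = weight ?xs" using Suc by simp
  have B: "?B = {\<omega> \<in> space \<Omega>. W (Suc N) \<omega> = w (Suc N) \<and> (\<forall>i\<le>N. W i \<omega> = w i)}"
    by (auto simp: le_Suc_eq)
  have "prob ?B = prob ?A * M (w N) (w (Suc N))"
  proof (cases "prob ?A > 0")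
    case True
    have "\<P>(\<omega> in \<Omega>. W (Suc N) \<omega> = w (Suc N) \<bar> \<forall>i\<le>N. W i \<omega> = w i) = M (w N) (w (Suc N))"
      using chain True Suc.prems[of "Suc N"] unfolding markov_chain_def by simp
    then show ?thesis using True unfolding B cond_prob_def by (simp add: field_simps)
  next
    case False
    then have A: "prob ?A = 0" using measure_nonneg[of \<Omega> ?A] by linarith
    have "prob ?B \<le> prob ?A" using initial_event by (intro finite_measure_mono) auto
    then have "prob ?B = 0" using A measure_nonneg[of \<Omega> ?B] by linarith
    then show ?thesis using A by (simp only: mult_zero_left)
  qed
  also have "\<dots> = \<rho> (hd ?xs) * (path_prob M ?xs * M (last ?xs) (w (Suc N)))"
    unfolding IH weight_def by simp
  also have "\<dots> = weight (?xs @ [w (Suc N)])"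
    unfolding weight_def by (subst path_prob_snoc) (simp_all add: hd_append)
  finally show ?case by simp
qed

lemma prob_prefix_eq:
  assumes "xs \<in> paths N"
  shows "{\<omega> \<in> space \<Omega>. prefix N \<omega> = xs} \<in> events"
    and "prob {\<omega> \<in> space \<Omega>. prefix N \<omega> = xs} = weight xs"
proof -
  have len: "length xs = Suc N" and "set xs \<subseteq> V" using assms by (auto simp: paths_def)
  then have V: "xs ! i \<in> V" if "i \<le> N" for i using that nth_mem[of i xs] by auto
  have xs: "xs = map (\<lambda>i. xs ! i) [0..<Suc N]" using len map_nth[of xs] by simp
  have eq: "{\<omega> \<in> space \<Omega>. prefix N \<omega> = xs} = {\<omega> \<in> space \<Omega>. \<forall>i\<le>N. W i \<omega> = xs ! i}"
    using prefix_eq_iff[of N _ "\<lambda>i. xs ! i"] unfolding xs[symmetric] by simp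
  show "{\<omega> \<in> space \<Omega>. prefix N \<omega> = xs} \<in> events" unfolding eq by (rule initial_event)
  show "prob {\<omega> \<in> space \<Omega>. prefix N \<omega> = xs} = weight xs"
    unfolding eq using prob_initial[of N "\<lambda>i. xs ! i"] V xs by simp
qed

lemma prob_prefix:
  "{\<omega> \<in> space \<Omega>. Q (prefix N \<omega>)} \<in> events"
  "prob {\<omega> \<in> space \<Omega>. Q (prefix N \<omega>)} = (\<Sum>xs\<in>paths N. of_bool (Q xs) * weight xs)"
proof -
  let ?X = "{xs \<in> paths N. Q xs}" and ?A = "\<lambda>xs. {\<omega> \<in> space \<Omega>. prefix N \<omega> = xs}"
  have eq: "{\<omega> \<in> space \<Omega>. Q (prefix N \<omega>)} = (\<Union>xs\<in>?X. ?A xs)" using prefix_in by auto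
  have fin: "finite ?X" by simp
  have ev: "?A ` ?X \<subseteq> events" using prob_prefix_eq(1) by auto
  show "{\<omega> \<in> space \<Omega>. Q (prefix N \<omega>)} \<in> events"
    unfolding eq using fin ev by (intro sets.finite_UN) auto
  have "prob (\<Union>xs\<in>?X. ?A xs) = (\<Sum>xs\<in>?X. prob (?A xs))"
    using fin ev by (intro finite_measure_finite_Union) (auto simp: disjoint_family_on_def)
  also have "\<dots> = (\<Sum>xs\<in>?X. weight xs)" using prob_prefix_eq(2) by (intro sum.cong) auto
  also have "\<dots> = (\<Sum>xs\<in>paths N. of_bool (Q xs) * weight xs)"
    by (intro sum.mono_neutral_cong_left) auto
  finally show "prob {\<omega> \<in> space \<Omega>. Q (prefix N \<omega>)} = (\<Sum>xs\<in>paths N. of_bool (Q xs) * weight xs)"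
    unfolding eq .
qed

lemma prt_event: "{\<omega> \<in> space \<Omega>. prt n (\<lambda>i. W i \<omega>) = t} \<in> events"
proof -
  let ?T = "\<lambda>N xs. prt n (\<lambda>i. xs ! min i N)"
  have T: "?T N (prefix N \<omega>) = prt n (\<lambda>i. W (min i N) \<omega>)" for N \<omega>
    by (simp add: prefix_def less_Suc_eq_le nth_upt del: upt_Suc)
  have "prt n (\<lambda>i. W i \<omega>) = t \<longleftrightarrow> (\<exists>N0. \<forall>N\<in>{N0..}. ?T N (prefix N \<omega>) = t)" for \<omega>
  proof -
    obtain N0 where N0: "\<And>N. N \<ge> N0 \<Longrightarrow> prt n (\<lambda>i. W (min i N) \<omega>) = prt n (\<lambda>i. W i \<omega>)"
      using prt_stopped[of n "\<lambda>i. W i \<omega>"] by auto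
    show ?thesis unfolding T
      using N0 by (metis atLeast_iff max.cobounded1 max.cobounded2)
  qed
  then have "{\<omega> \<in> space \<Omega>. prt n (\<lambda>i. W i \<omega>) = t}
      = {\<omega> \<in> space \<Omega>. \<exists>N0. \<forall>N\<in>{N0..}. ?T N (prefix N \<omega>) = t}" by simp
  also have "\<dots> \<in> events"
    by (intro sets.sets_Collect_countable_Ex sets.sets_Collect_countable_Ball prob_prefix(1))
  finally show ?thesis .
qed

lemma prt_law_tree_mass:
  assumes n: "1 \<le> n"
  shows "\<bar>prt_law \<Omega> n W t - tree_mass n N t\<bar> \<le> short_mass n N"
proof -
  let ?A = "{\<omega> \<in> space \<Omega>. prt n (\<lambda>i. W i \<omega>) = t}"
  let ?G = "{\<omega> \<in> space \<Omega>. n \<le> card (set (prefix N \<omega>)) \<and> pioneer_tree n (prefix N \<omega>) = t}"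
  let ?B = "{\<omega> \<in> space \<Omega>. card (set (prefix N \<omega>)) < n}"
  have set_prefix: "set (prefix N \<omega>) = (\<lambda>i. W i \<omega>) ` {0..N}" for \<omega>
    unfolding prefix_def by (simp only: set_map set_upt atLeastLessThanSuc_atLeastAtMost)
  have prt: "prt n (\<lambda>i. W i \<omega>) = pioneer_tree n (prefix N \<omega>)" if "n \<le> card (set (prefix N \<omega>))" for \<omega>
    using prt_eq_pioneer_tree[OF n, of "\<lambda>i. W i \<omega>" N] that[unfolded set_prefix]
    by (simp only: prefix_def)
  have G: "prob ?G = tree_mass n N t" unfolding tree_mass_def by (rule prob_prefix(2))
  have B: "prob ?B = short_mass n N" unfolding short_mass_def by (rule prob_prefix(2))
  have ev: "?A \<in> events" "?G \<in> events" "?B \<in> events"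
    using prt_event prob_prefix(1)[of "\<lambda>xs. n \<le> card (set xs) \<and> pioneer_tree n xs = t"]
      prob_prefix(1)[of "\<lambda>xs. card (set xs) < n"] by auto
  have "?G \<subseteq> ?A" using prt by auto
  then have "prob ?G \<le> prob ?A" using ev by (intro finite_measure_mono)
  moreover have "?A \<subseteq> ?G \<union> ?B" using prt by (auto simp: not_le)
  then have "prob ?A \<le> prob (?G \<union> ?B)" using ev by (intro finite_measure_mono) auto
  moreover have "prob (?G \<union> ?B) \<le> prob ?G + prob ?B" using ev by (intro measure_Un_le)
  ultimately show ?thesis unfolding prt_law_def using G B by simp
qed

lemma tree_mass_tendsto:
  assumes "1 \<le> n" "n \<le> card V"
  shows "(\<lambda>N. tree_mass n N t) \<longlonglongrightarrow> prt_law \<Omega> n W t"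
proof -
  have "(\<lambda>N. tree_mass n N t - prt_law \<Omega> n W t) \<longlonglongrightarrow> 0"
    by (rule tendsto_0_le[OF short_mass_tendsto_0[OF assms(2)], where K = 1])
      (use prt_law_tree_mass[OF assms(1), of t] short_mass_nonneg in
        \<open>auto simp: abs_minus_commute intro!: always_eventually\<close>)
  then show ?thesis by (simp add: LIM_zero_iff)
qed

lemma prt_law_invariant:
  assumes n: "1 \<le> n" "n \<le> card V"
  shows "invariant_distribution (S V E n) (K V M \<rho>) (prt_law \<Omega> n W)"
  unfolding invariant_distribution_def
proof (intro conjI ballI)
  show "prt_law \<Omega> n W s \<ge> 0" for s by (simp add: prt_law_def)
  show "(\<Sum>s\<in>S V E n. prt_law \<Omega> n W s) = 1"
  proof (rule LIMSEQ_unique)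
    show "(\<lambda>N. \<Sum>s\<in>S V E n. tree_mass n N s) \<longlonglongrightarrow> (\<Sum>s\<in>S V E n. prt_law \<Omega> n W s)"
      by (intro tendsto_sum tree_mass_tendsto n)
    have "(\<lambda>N. 1 - short_mass n N) \<longlonglongrightarrow> 1 - 0"
      by (intro tendsto_intros short_mass_tendsto_0 n)
    then show "(\<lambda>N. \<Sum>s\<in>S V E n. tree_mass n N s) \<longlonglongrightarrow> 1"
      by (simp add: tree_mass_total[OF n(1)])
  qed
  fix t
  let ?next = "\<lambda>N. \<Sum>s\<in>S V E n. tree_mass n N s * K V M \<rho> s t"
  show "(\<Sum>s\<in>S V E n. prt_law \<Omega> n W s * K V M \<rho> s t) = prt_law \<Omega> n W t"
  proof (rule LIMSEQ_unique)
    show "?next \<longlonglongrightarrow> (\<Sum>s\<in>S V E n. prt_law \<Omega> n W s * K V M \<rho> s t)"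
      by (intro tendsto_intros tree_mass_tendsto n)
    have "(\<lambda>N. tree_mass n (Suc N) t - ?next N) \<longlonglongrightarrow> 0"
      by (rule tendsto_0_le[OF short_mass_tendsto_0[OF n(2)], where K = 1])
        (use tree_mass_step[OF n(1), of _ t] short_mass_nonneg in
          \<open>auto intro!: always_eventually\<close>)
    from tendsto_diff[OF LIMSEQ_Suc[OF tree_mass_tendsto[OF n, of t]] this]
    show "?next \<longlonglongrightarrow> prt_law \<Omega> n W t" by simp
  qed
qed

end

theorem proposition24:
  fixes V :: "'v set" and E :: "'v set set" and M :: "'v \<Rightarrow> 'v \<Rightarrow> real"
    and \<rho> :: "'v \<Rightarrow> real" and n :: nat
  assumes "finite V" and "connected_graph V E"
    and "transition_matrix V M" and "positive_on V E M"
    and "invariant_distribution V M \<rho>"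
    and "1 \<le> n" and "n \<le> card V"
  shows "ergodic_on (S V E n) (K V M \<rho>) \<and>
    (\<forall>(\<Omega> :: 'w measure) W.
       markov_chain \<Omega> V M W \<and> (\<forall>v\<in>V. \<P>(\<omega> in \<Omega>. W 0 \<omega> = v) = \<rho> v) \<longrightarrow>
       invariant_distribution (S V E n) (K V M \<rho>) (prt_law \<Omega> n W) \<and>
       (\<forall>\<mu>. invariant_distribution (S V E n) (K V M \<rho>) \<mu> \<longrightarrow>
            (\<forall>s\<in>S V E n. \<mu> s = prt_law \<Omega> n W s)) \<and>
       (\<forall>s\<in>S V E n. prt_law \<Omega> n W s > 0))"
proof (intro conjI allI impI)
  interpret positive_chain V E M \<rho> using assms by unfold_locales
  show erg: "ergodic_on (S V E n) (K V M \<rho>)" using K_ergodic assms by blast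
  fix \<Omega> :: "'w measure" and W
  assume W: "markov_chain \<Omega> V M W \<and> (\<forall>v\<in>V. \<P>(\<omega> in \<Omega>. W 0 \<omega> = v) = \<rho> v)"
  then interpret prob_space \<Omega> by (simp add: markov_chain_def)
  interpret positive_chain_process V E M \<rho> \<Omega> W using W by unfold_locales auto
  show inv: "invariant_distribution (S V E n) (K V M \<rho>) (prt_law \<Omega> n W)"
    using prt_law_invariant assms by blast
  note irr = erg[unfolded ergodic_on_def]
  show "\<forall>s\<in>S V E n. \<mu> s = prt_law \<Omega> n W s"
    if "invariant_distribution (S V E n) (K V M \<rho>) \<mu>" for \<mu>
    using invariant_distribution_unique[OF _ _ _ that inv] irr by blast
  show "\<forall>s\<in>S V E n. prt_law \<Omega> n W s > 0"
    using invariant_distribution_pos[OF _ _ _ inv] irr by blast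
qed

end
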